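(* For any public-coins proper synchronous $k$-player protocol $\pi$ whose players have $n$-bit inputs $X$ with $(X,M,Z)\sim\mu^n$, $$\mathsf{PIC}_{\mu^n}(\pi)\ge\tfrac12\,\mathsf{SMIC}_{\mu^n}(\pi).$$
   Context: Model (asynchronous number-in-hand peer-to-peer model). There are $k$ players. Player $i$ receives an input $x_i$, has a private random string $R_i$, and all players share a public random string $R^p$. Every pair of players is joined by a bidirectional link with finite but unbounded delivery time and FIFO order in each direction. The view of player $i$ consists of $x_i$, $R_i$, $R^p$ and the messages read so far. A protocol specifies, for each player $i$ and each local round $\ell\ge1$, functions of the view of player $i$ at the end of local round $\ell-1$ giving: a set of recipients and, for each recipient $j$, a self-delimiting message in $\{0,1\}^*$ sent by $i$ to $j$; a value in $\{0,1\}^*\cup\{\bot\}$ — if not $\bot$, player $i$ stops and outputs it; otherwise a set of players from each of which player $i$ then waits to read one complete message, ending the local round. $\Pi_{i,j}^s$ is the sequence of messages sent by $i$ to $j$, $\Pi_{i,j}^r$ the sequence of messages read by $i$ from $j$, $\Pi_i=(\Pi_{i,j}^s,\Pi_{i,j}^r)_{j\ne i}$. A public-coins protocol uses no private randomness. A protocol is proper synchronous if there is an integer $t_f$ such that for every player $i$, input $x$ and randomness $r$: in every local round $t<t_f$ player $i$ sends messages to all other players and reads messages from all other players, and player $i$ stops at local round $t_f$. Distribution $\mu$ of $(X,M,Z)$ with $X\in\{0,1\}^k$: draw $M$ with $\Pr[M=0]=\frac23$, $\Pr[M=1]=\frac13$, independently $Z$ uniform in $\{1,\dots,k\}$; set $X_Z=0$;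 if $M=0$ draw $X_{-Z}$ uniformly in $\{0,1\}^{k-1}$, if $M=1$ set $X_{-Z}=1^{k-1}$. $\mu^n$: $n$ independent copies $(X^t,M^t,Z^t)_{t=1}^n$, player $i$'s input being $X_i=(X_i^1,\dots,X_i^n)$, $M=(M^t)_t$, $Z=(Z^t)_t$, independent of the randomness. Definitions: $$\mathsf{PIC}_{\mu^n}(\pi)=\sum_{i=1}^kI(X_{-i};\Pi_iR_{-i}\mid X_iR_iR^p),\qquad \mathsf{SMIC}_{\mu^n}(\pi)=\sum_{i=1}^k\big(I(X_i;\Pi_i\mid MZR^p)+I(M;\Pi_i\mid X_iZR^p)\big).$$
   Formalization: "Player i stops at local round t_f" is taken to include sending no messages in round t_f; otherwise the claim fails (t_f=1, k≥2, every player sends its input and stops: PIC=0 but SMIC>0). *)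

theory Defs
  imports "HOL-Probability.Probability" "HOL-Library.Sublist" "HOL-Library.Confluence"
begin

section \<open>Protocols\<close>

text \<open>
  Players are the elements of a finite type \<open>'k\<close>, so that \<open>k = CARD('k)\<close>; \<open>'x\<close> is the type of a
  player's input.  The random strings of the players and the public random string are drawn from
  arbitrary probability spaces (on types \<open>'r\<close> and \<open>'s\<close>), for instance sequences of fair coin tosses.
\<close>

type_synonym msg = "bool list"

text \<open>Own input, private string, public string, and for each player the messages read from it.\<close>
type_synonym ('k, 'x, 'r, 's) view = "'x \<times> 'r \<times> 's \<times> ('k \<Rightarrow> msg list)"

text \<open>
  The last three fields take a player, a local round \<open>l \<ge> 1\<close> and the player's view at the end of
  local round \<open>l - 1\<close>.  The recipients in a round are the players to which \<open>send\<close> assigns a message;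
  \<open>decide\<close> gives the output, with \<open>None\<close> for \<open>\<bottom>\<close>; \<open>await\<close> gives the players to wait for and
  matters only if \<open>decide\<close> is \<open>None\<close>.
\<close>
record ('k, 'x, 'r, 's) protocol =
  priv_coins :: "'k \<Rightarrow> 'r measure"
  pub_coins :: "'s measure"
  send :: "'k \<Rightarrow> nat \<Rightarrow> ('k, 'x, 'r, 's) view \<Rightarrow> 'k \<Rightarrow> msg option"
  decide :: "'k \<Rightarrow> nat \<Rightarrow> ('k, 'x, 'r, 's) view \<Rightarrow> bool list option"
  await :: "'k \<Rightarrow> nat \<Rightarrow> ('k, 'x, 'r, 's) view \<Rightarrow> 'k set"

definition view_space ::
  "('k, 'x, 'r, 's) protocol \<Rightarrow> 'k \<Rightarrow> ('k, 'x, 'r, 's) view measure" where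
  "view_space \<pi> i =
     count_space UNIV \<Otimes>\<^sub>M priv_coins \<pi> i \<Otimes>\<^sub>M pub_coins \<pi> \<Otimes>\<^sub>M count_space UNIV"

definition link_messages :: "('k, 'x, 'r, 's) protocol \<Rightarrow> 'k \<Rightarrow> 'k \<Rightarrow> msg set" where
  "link_messages \<pi> i j =
     {m. \<exists>l\<ge>1. \<exists>v\<in>space (view_space \<pi> i). send \<pi> i l v j = Some m}"

text \<open>
  Messages are self-delimiting: on each directed link they form a prefix-free code.  Measurability
  is what makes the transcript a random variable; it is automatic when the random strings range
  over a countable set with the discrete sigma-algebra.
\<close>
definition valid_protocol :: "('k, 'x, 'r, 's) protocol \<Rightarrow> bool" where
  "valid_protocol \<pi> \<longleftrightarrow>
     (\<forall>i. prob_space (priv_coins \<pi> i)) \<and> prob_space (pub_coins \<pi>) \<and>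
     (\<forall>i. \<forall>l\<ge>1.
        send \<pi> i l \<in> view_space \<pi> i \<rightarrow>\<^sub>M count_space UNIV \<and>
        decide \<pi> i l \<in> view_space \<pi> i \<rightarrow>\<^sub>M count_space UNIV \<and>
        await \<pi> i l \<in> view_space \<pi> i \<rightarrow>\<^sub>M count_space UNIV \<and>
        (\<forall>v\<in>space (view_space \<pi> i). send \<pi> i l v i = None \<and> i \<notin> await \<pi> i l v)) \<and>
     (\<forall>i j. \<forall>m\<in>link_messages \<pi> i j. \<forall>m'\<in>link_messages \<pi> i j. prefix m m' \<longrightarrow> m = m')"

definition public_coins_protocol :: "('k, 'x, 'r, 's) protocol \<Rightarrow> bool" where
  "public_coins_protocol \<pi> \<longleftrightarrow>
     (\<forall>i. \<forall>l\<ge>1. \<forall>x s h. \<forall>r\<in>space (priv_coins \<pi> i). \<forall>r'\<in>space (priv_coins \<pi> i).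
        send \<pi> i l (x, r, s, h) = send \<pi> i l (x, r', s, h) \<and>
        decide \<pi> i l (x, r, s, h) = decide \<pi> i l (x, r', s, h) \<and>
        await \<pi> i l (x, r, s, h) = await \<pi> i l (x, r', s, h))"


section \<open>Asynchronous executions\<close>

text \<open>
  \<open>Waiting W\<close>: still to read one message from each player in \<open>W\<close> before the local round ends.
\<close>
datatype 'k phase = Ready | Waiting "'k set" | Stopped "bool list"

record 'k player_state =
  lround :: nat
  phase :: "'k phase"
  sent :: "'k \<Rightarrow> msg list"
  got :: "'k \<Rightarrow> msg list"

type_synonym 'k config = "'k \<Rightarrow> 'k player_state"

definition initial :: "'k config" where
  "initial = (\<lambda>i. \<lparr>lround = 1, phase = Ready, sent = (\<lambda>_. []), got = (\<lambda>_. [])\<rparr>)"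

definition view_of :: "('k \<Rightarrow> 'x) \<Rightarrow> ('k \<Rightarrow> 'r) \<Rightarrow> 's \<Rightarrow> 'k config \<Rightarrow> 'k \<Rightarrow> ('k, 'x, 'r, 's) view" where
  "view_of x r s c i = (x i, r i, s, got (c i))"

definition begin_round ::
  "('k, 'x, 'r, 's) protocol \<Rightarrow> 'k \<Rightarrow> ('k, 'x, 'r, 's) view \<Rightarrow> 'k player_state \<Rightarrow> 'k player_state" where
  "begin_round \<pi> i v p = p\<lparr>
     sent := (\<lambda>j. sent p j @ (case send \<pi> i (lround p) v j of None \<Rightarrow> [] | Some m \<Rightarrow> [m])),
     phase := (case decide \<pi> i (lround p) v of
                 Some y \<Rightarrow> Stopped y | None \<Rightarrow> Waiting (await \<pi> i (lround p) v))\<rparr>"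

text \<open>
  A move of player \<open>i\<close>, which takes it to a new local state.  Between two moves of one player any
  moves of others may take place, which covers all finite delivery times; a link is FIFO because
  the message that \<open>i\<close> reads from \<open>j\<close> is the first one of \<open>sent (c j) i\<close> not yet read by \<open>i\<close>.
\<close>
inductive move :: "('k, 'x, 'r, 's) protocol \<Rightarrow> ('k \<Rightarrow> 'x) \<Rightarrow> ('k \<Rightarrow> 'r) \<Rightarrow> 's \<Rightarrow>
    'k config \<Rightarrow> 'k \<Rightarrow> 'k player_state \<Rightarrow> bool"
  for \<pi> x r s c i where
  begin_move: "phase (c i) = Ready \<Longrightarrow>
     move \<pi> x r s c i (begin_round \<pi> i (view_of x r s c i) (c i))"
| read_move: "phase (c i) = Waiting W \<Longrightarrow> j \<in> W \<Longrightarrow> length (got (c i) j) < length (sent (c j) i) \<Longrightarrow>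
     move \<pi> x r s c i ((c i)\<lparr>
        phase := Waiting (W - {j}),
        got := (got (c i))(j := got (c i) j @ [sent (c j) i ! length (got (c i) j)])\<rparr>)"
| end_move: "phase (c i) = Waiting {} \<Longrightarrow>
     move \<pi> x r s c i ((c i)\<lparr>lround := Suc (lround (c i)), phase := Ready\<rparr>)"

definition step :: "('k, 'x, 'r, 's) protocol \<Rightarrow> ('k \<Rightarrow> 'x) \<Rightarrow> ('k \<Rightarrow> 'r) \<Rightarrow> 's \<Rightarrow>
    'k config \<Rightarrow> 'k config \<Rightarrow> bool" where
  "step \<pi> x r s c c' \<longleftrightarrow> (\<exists>i p. move \<pi> x r s c i p \<and> c' = c(i := p))"

definition reachable ::
  "('k, 'x, 'r, 's) protocol \<Rightarrow> ('k \<Rightarrow> 'x) \<Rightarrow> ('k \<Rightarrow> 'r) \<Rightarrow> 's \<Rightarrow> 'k config \<Rightarrow> bool" where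
  "reachable \<pi> x r s c \<longleftrightarrow> (step \<pi> x r s)\<^sup>*\<^sup>* initial c"

definition final ::
  "('k, 'x, 'r, 's) protocol \<Rightarrow> ('k \<Rightarrow> 'x) \<Rightarrow> ('k \<Rightarrow> 'r) \<Rightarrow> 's \<Rightarrow> 'k config \<Rightarrow> bool" where
  "final \<pi> x r s c \<longleftrightarrow> reachable \<pi> x r s c \<and> (\<nexists>c'. step \<pi> x r s c c')"

text \<open>The outcome does not depend on the delivery times.\<close>

lemma move_sent:
  assumes "move \<pi> x r s c i p"
  shows "\<exists>ms. sent p j = sent (c i) j @ ms"
  using assms by cases (auto simp: begin_round_def)

lemma move_commute:
  assumes "move \<pi> x r s c i p" "move \<pi> x r s c i' p'" "i \<noteq> i'"
  shows "move \<pi> x r s (c(i' := p')) i p"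
  using assms(1)
proof cases
  case begin_move
  have "view_of x r s c i = view_of x r s (c(i' := p')) i"
    using assms(3) by (simp add: view_of_def)
  with begin_move show ?thesis
    using assms(3) move.begin_move[of "c(i' := p')" i \<pi> x r s] by simp
next
  case (read_move W j)
  obtain ms where ms: "sent p' i = sent (c i') i @ ms"
    using move_sent[OF assms(2)] by blast
  define c2 where "c2 = c(i' := p')"
  have "c2 i = c i"
    using assms(3) by (simp add: c2_def)
  moreover have "length (got (c i) j) < length (sent (c2 j) i)"
    and "sent (c2 j) i ! length (got (c i) j) = sent (c j) i ! length (got (c i) j)"
    using read_move ms by (auto simp: c2_def nth_append)
  ultimately have "move \<pi> x r s c2 i p"
    using read_move move.read_move[of c2 i W j \<pi> x r s] by simp
  then show ?thesis
    by (simp add: c2_def)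
next
  case end_move
  then show ?thesis
    using assms(3) move.end_move[of "c(i' := p')" i \<pi> x r s] by simp
qed

lemma move_diamond:
  assumes "move \<pi> x r s c i p" "move \<pi> x r s c i p'" "p \<noteq> p'"
  shows "\<exists>q. move \<pi> x r s (c(i := p)) i q \<and> move \<pi> x r s (c(i := p')) i q"
proof -
  obtain W j where W: "phase (c i) = Waiting W" and j: "j \<in> W"
    "length (got (c i) j) < length (sent (c j) i)"
    and p: "p = (c i)\<lparr>phase := Waiting (W - {j}),
        got := (got (c i))(j := got (c i) j @ [sent (c j) i ! length (got (c i) j)])\<rparr>"
    using assms by (auto elim!: move.cases)
  obtain j' where j': "j' \<in> W" "length (got (c i) j') < length (sent (c j') i)"
    and p': "p' = (c i)\<lparr>phase := Waiting (W - {j'}),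
        got := (got (c i))(j' := got (c i) j' @ [sent (c j') i ! length (got (c i) j')])\<rparr>"
    using assms(2) W j by (auto elim!: move.cases)
  have "j \<noteq> j'"
    using assms(3) p p' by auto
  have *: "W - {j} - {j'} = W - {j'} - {j}"
    by auto
  have sent_eq: "sent ((c(i := p)) l) i = sent (c l) i" "sent ((c(i := p')) l) i = sent (c l) i" for l
    by (auto simp: p p')
  define g where "g = (\<lambda>l. got (c i) l @ [sent (c l) i ! length (got (c i) l)])"
  define q where "q = (c i)\<lparr>phase := Waiting (W - {j} - {j'}),
    got := (got (c i))(j := g j, j' := g j')\<rparr>"
  have q': "q = (c i)\<lparr>phase := Waiting (W - {j'} - {j}),
    got := (got (c i))(j' := g j', j := g j)\<rparr>"
    using fun_upd_twist[OF \<open>j \<noteq> j'\<close>, of "got (c i)" "g j" "g j'"] by (simp only: q_def *)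
  have "move \<pi> x r s (c(i := p)) i q"
    using move.read_move[of "c(i := p)" i "W - {j}" j' \<pi> x r s] j j' \<open>j \<noteq> j'\<close>
    unfolding sent_eq by (simp add: p q_def g_def)
  moreover have "move \<pi> x r s (c(i := p')) i q"
    using move.read_move[of "c(i := p')" i "W - {j'}" j \<pi> x r s] j j' \<open>j \<noteq> j'\<close>
    unfolding sent_eq by (simp add: p' q' g_def)
  ultimately show ?thesis
    by blast
qed

lemma step_diamond:
  assumes "step \<pi> x r s c a" "step \<pi> x r s c b" "a \<noteq> b"
  shows "\<exists>d. step \<pi> x r s a d \<and> step \<pi> x r s b d"
proof -
  obtain i p i' p' where m: "move \<pi> x r s c i p" "a = c(i := p)"
    "move \<pi> x r s c i' p'" "b = c(i' := p')"
    using assms unfolding step_def by blast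
  show ?thesis
  proof (cases "i = i'")
    case True
    then obtain q where "move \<pi> x r s a i q" "move \<pi> x r s b i q"
      using move_diamond[of \<pi> x r s c i p p'] m assms(3) by auto
    then have "step \<pi> x r s a (a(i := q))" "step \<pi> x r s b (b(i := q))"
      unfolding step_def by blast+
    moreover have "a(i := q) = b(i := q)"
      using m True by simp
    ultimately show ?thesis
      by auto
  next
    case False
    then have "move \<pi> x r s b i p" "move \<pi> x r s a i' p'"
      using move_commute[OF m(1) m(3)] move_commute[OF m(3) m(1)] m(2,4) by auto
    then have "step \<pi> x r s b (b(i := p))" "step \<pi> x r s a (a(i' := p'))"
      unfolding step_def by blast+
    moreover have "a(i' := p') = b(i := p)"
      using fun_upd_twist[OF False, of c p p'] by (simp only: m)
    ultimately show ?thesis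
      by auto
  qed
qed

lemma final_unique:
  assumes "final \<pi> x r s c" "final \<pi> x r s c'"
  shows "c = c'"
proof -
  have "strong_confluentp (step \<pi> x r s)"
  proof (rule strong_confluentpI)
    fix c a b assume ab: "step \<pi> x r s c a" "step \<pi> x r s c b"
    show "\<exists>u. (step \<pi> x r s)\<^sup>*\<^sup>* a u \<and> (step \<pi> x r s)\<^sup>=\<^sup>= b u"
    proof (cases "a = b")
      case False
      then show ?thesis
        using step_diamond[OF ab] by auto
    qed auto
  qed
  then have "confluentp (step \<pi> x r s)"
    by (rule strong_confluentp_imp_confluentp)
  moreover have "(step \<pi> x r s)\<^sup>*\<^sup>* initial c" "(step \<pi> x r s)\<^sup>*\<^sup>* initial c'"
    using assms by (simp_all add: final_def reachable_def)
  ultimately obtain u where "(step \<pi> x r s)\<^sup>*\<^sup>* c u" "(step \<pi> x r s)\<^sup>*\<^sup>* c' u"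
    by (blast dest: confluentpD)
  then have "c = u" "c' = u"
    using assms by (auto simp: final_def elim: converse_rtranclpE)
  then show ?thesis
    by simp
qed

text \<open>By \<open>final_unique\<close> the description determines the final configuration whenever there is one.\<close>
definition final_config ::
  "('k, 'x, 'r, 's) protocol \<Rightarrow> ('k \<Rightarrow> 'x) \<Rightarrow> ('k \<Rightarrow> 'r) \<Rightarrow> 's \<Rightarrow> 'k config" where
  "final_config \<pi> x r s = (THE c. final \<pi> x r s c)"

type_synonym 'k transcript = "('k \<Rightarrow> msg list) \<times> ('k \<Rightarrow> msg list)"

definition transcript ::
  "('k, 'x, 'r, 's) protocol \<Rightarrow> ('k \<Rightarrow> 'x) \<Rightarrow> ('k \<Rightarrow> 'r) \<Rightarrow> 's \<Rightarrow> 'k \<Rightarrow> 'k transcript" where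
  "transcript \<pi> x r s i =
     (sent (final_config \<pi> x r s i), got (final_config \<pi> x r s i))"

text \<open>
  Stopping at local round \<open>tf\<close> includes sending nothing in it.  Messages sent in round \<open>tf\<close> would
  never be read, and they would have to be excluded: if \<open>tf = 1\<close> and everybody sent its input
  before stopping, \<open>PIC\<close> below would vanish but \<open>SMIC\<close> would not.
\<close>
definition proper_synchronous :: "('k, 'x, 'r, 's) protocol \<Rightarrow> bool" where
  "proper_synchronous \<pi> \<longleftrightarrow>
     (\<exists>tf\<ge>1. \<forall>x. \<forall>r\<in>space (PiM UNIV (priv_coins \<pi>)). \<forall>s\<in>space (pub_coins \<pi>). \<forall>c i.
        reachable \<pi> x r s c \<and> phase (c i) = Ready \<longrightarrow>
        (let t = lround (c i); v = view_of x r s c i in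
          (t < tf \<longrightarrow> (\<forall>j. j \<noteq> i \<longrightarrow> send \<pi> i t v j \<noteq> None) \<and>
             decide \<pi> i t v = None \<and> await \<pi> i t v = - {i}) \<and>
          (t = tf \<longrightarrow> (\<forall>j. send \<pi> i t v j = None) \<and> decide \<pi> i t v \<noteq> None)))"


section \<open>The input distribution\<close>

text \<open>A sample is \<open>(X, M, Z)\<close>, with \<open>False\<close> and \<open>True\<close> for 0 and 1.\<close>
definition mu :: "(('k::finite \<Rightarrow> bool) \<times> bool \<times> 'k) pmf" where
  "mu = do {
     m \<leftarrow> bernoulli_pmf (1/3);
     z \<leftarrow> pmf_of_set UNIV;
     x \<leftarrow> (if m then return_pmf (\<lambda>i. i \<noteq> z) else pmf_of_set {x. \<not> x z});
     return_pmf (x, m, z)}"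

text \<open>The \<open>n = CARD('n)\<close> coordinates of the inputs are indexed by \<open>'n\<close>.\<close>
definition mu_n :: "('n::finite \<Rightarrow> ('k::finite \<Rightarrow> bool) \<times> bool \<times> 'k) pmf" where
  "mu_n = Pi_pmf UNIV undefined (\<lambda>_. mu)"


section \<open>Information costs\<close>

type_synonym ('k, 'n, 'r, 's) sample =
  "('n \<Rightarrow> ('k \<Rightarrow> bool) \<times> bool \<times> 'k) \<times> ('k \<Rightarrow> 'r) \<times> 's"

definition sample_space ::
  "('k::finite, 'n::finite \<Rightarrow> bool, 'r, 's) protocol \<Rightarrow> ('k, 'n, 'r, 's) sample measure" where
  "sample_space \<pi> = measure_pmf mu_n \<Otimes>\<^sub>M PiM UNIV (priv_coins \<pi>) \<Otimes>\<^sub>M pub_coins \<pi>"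

definition rv_X :: "('k, 'n, 'r, 's) sample \<Rightarrow> 'k \<Rightarrow> 'n \<Rightarrow> bool" where
  "rv_X = (\<lambda>(w, r, s) i t. fst (w t) i)"

definition rv_M :: "('k, 'n, 'r, 's) sample \<Rightarrow> 'n \<Rightarrow> bool" where
  "rv_M = (\<lambda>(w, r, s) t. fst (snd (w t)))"

definition rv_Z :: "('k, 'n, 'r, 's) sample \<Rightarrow> 'n \<Rightarrow> 'k" where
  "rv_Z = (\<lambda>(w, r, s) t. snd (snd (w t)))"

definition rv_R :: "('k, 'n, 'r, 's) sample \<Rightarrow> 'k \<Rightarrow> 'r" where
  "rv_R = (\<lambda>(w, r, s). r)"

definition rv_Rp :: "('k, 'n, 'r, 's) sample \<Rightarrow> 's" where
  "rv_Rp = (\<lambda>(w, r, s). s)"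

definition rv_Pi ::
  "('k, 'n \<Rightarrow> bool, 'r, 's) protocol \<Rightarrow> 'k \<Rightarrow> ('k, 'n, 'r, 's) sample \<Rightarrow> 'k transcript" where
  "rv_Pi \<pi> i \<omega> = transcript \<pi> (rv_X \<omega>) (rv_R \<omega>) (rv_Rp \<omega>) i"

text \<open>
  Conditional mutual information in bits.  In the library's notion the three measures only serve
  as the target spaces of the three random variables.
\<close>
abbreviation cmi ::
  "('k::finite, 'n::finite \<Rightarrow> bool, 'r, 's) protocol \<Rightarrow> 'a measure \<Rightarrow> 'b measure \<Rightarrow> 'c measure \<Rightarrow>
    (('k, 'n, 'r, 's) sample \<Rightarrow> 'a) \<Rightarrow> (('k, 'n, 'r, 's) sample \<Rightarrow> 'b) \<Rightarrow>
    (('k, 'n, 'r, 's) sample \<Rightarrow> 'c) \<Rightarrow> real" where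
  "cmi \<pi> \<equiv> prob_space.conditional_mutual_information (sample_space \<pi>) 2"

text \<open>A family \<open>f\<close> without its component \<open>i\<close> is \<open>restrict f (- {i})\<close>.\<close>
definition PIC :: "('k::finite, 'n::finite \<Rightarrow> bool, 'r, 's) protocol \<Rightarrow> real" where
  "PIC \<pi> = (\<Sum>i\<in>UNIV. cmi \<pi>
     (count_space UNIV)
     (count_space UNIV \<Otimes>\<^sub>M PiM (- {i}) (priv_coins \<pi>))
     (count_space UNIV \<Otimes>\<^sub>M priv_coins \<pi> i \<Otimes>\<^sub>M pub_coins \<pi>)
     (\<lambda>\<omega>. restrict (rv_X \<omega>) (- {i}))
     (\<lambda>\<omega>. (rv_Pi \<pi> i \<omega>, restrict (rv_R \<omega>) (- {i})))
     (\<lambda>\<omega>. (rv_X \<omega> i, rv_R \<omega> i, rv_Rp \<omega>)))"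

definition SMIC :: "('k::finite, 'n::finite \<Rightarrow> bool, 'r, 's) protocol \<Rightarrow> real" where
  "SMIC \<pi> = (\<Sum>i\<in>UNIV.
     cmi \<pi>
       (count_space UNIV)
       (count_space UNIV)
       (count_space UNIV \<Otimes>\<^sub>M count_space UNIV \<Otimes>\<^sub>M pub_coins \<pi>)
       (\<lambda>\<omega>. rv_X \<omega> i)
       (rv_Pi \<pi> i)
       (\<lambda>\<omega>. (rv_M \<omega>, rv_Z \<omega>, rv_Rp \<omega>)) +
     cmi \<pi>
       (count_space UNIV)
       (count_space UNIV)
       (count_space UNIV \<Otimes>\<^sub>M count_space UNIV \<Otimes>\<^sub>M pub_coins \<pi>)
       rv_M
       (rv_Pi \<pi> i)
       (\<lambda>\<omega>. (rv_X \<omega> i, rv_Z \<omega>, rv_Rp \<omega>)))"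

end

theory Submission
  imports Defs
begin

text \<open>
  Fix the public coins.  The transcripts are then functions of the input, and \<open>PIC\<close> becomes
  \<open>\<Sum>\<^sub>i H(\<Pi>\<^sub>i | X\<^sub>i)\<close>.  Each term \<open>I(M; \<Pi>\<^sub>i | X\<^sub>i Z)\<close> is at most
  \<open>H(\<Pi>\<^sub>i | X\<^sub>i)\<close>.  For the other terms let \<open>W = (M, Z)\<close> and let \<open>\<Pi>\<close> be all the messages.
  The \<open>X\<^sub>i\<close> are independent given \<open>W\<close>, so that
  \<open>\<Sum>\<^sub>i I(X\<^sub>i; \<Pi>\<^sub>i | W) \<le> \<Sum>\<^sub>i I(X\<^sub>i; \<Pi> | W) \<le> H(\<Pi> | W)\<close>; and since everything sent is also
  read, each message belongs to two transcripts, from which submodularity of entropy and once more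
  independence give \<open>H(\<Pi> | W) \<le> \<Sum>\<^sub>i H(\<Pi>\<^sub>i | X\<^sub>i W) \<le> \<Sum>\<^sub>i H(\<Pi>\<^sub>i | X\<^sub>i)\<close>.
\<close>

section \<open>Entropy of functions of a finite random variable\<close>

text \<open>The two sums in \<open>SMIC\<close> are bounded by \<open>PIC\<close> separately, whence
  the factor 1/2. For the first of them the point is double counting:
  \<open>\<Sum>\<^sub>i H(X\<^sub>i, \<Pi>\<^sub>i | W)\<close> pays for every message twice. One
  copy, together with the inputs, gives \<open>H(X, \<Pi> | W)\<close>, which is
  \<open>H(X | W)\<close> because the inputs determine the messages, and which
  \<open>\<Sum>\<^sub>i H(X\<^sub>i | W)\<close> cancels; the other copy remains as
  \<open>H(\<Pi> | W)\<close>. Independence has to be conditional on M as well as Z: given Z alone,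
  the bits of one coordinate are in general correlated through the hidden M. Entropy is therefore
  defined only for functions of the finite discrete part of the sample, with the strings frozen, and
  each \<open>cmi\<close> is shown to be the expectation over the strings of a combination of such
  entropies. This works because the conditioning variables contain the public string itself.\<close>

definition cell_prob :: "'w::finite pmf \<Rightarrow> ('w \<Rightarrow> 'a) \<Rightarrow> 'w \<Rightarrow> real" where
  "cell_prob p f w = (\<Sum>u\<in>UNIV. if f u = f w then pmf p u else 0)"

text \<open>Shannon entropy as the mean of minus the log mass of the cell through the sample point.
  Summing over sample points instead of values leaves the value type arbitrary and makes the result
  depend on \<open>f\<close> only through its partition of \<open>'w\<close>. Where
  \<open>cell_prob\<close> vanishes, so does the weight.\<close>

definition ent :: "'w::finite pmf \<Rightarrow> ('w \<Rightarrow> 'a) \<Rightarrow> real" where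
  "ent p f = - (\<Sum>w\<in>UNIV. pmf p w * log 2 (cell_prob p f w))"

text \<open>Refinement of partitions. Entropies of variables with different value types are compared
  through it.\<close>

definition determines :: "('w \<Rightarrow> 'a) \<Rightarrow> ('w \<Rightarrow> 'b) \<Rightarrow> bool" where
  "determines g f \<longleftrightarrow> (\<forall>u v. g u = g v \<longrightarrow> f u = f v)"

lemma determinesI: "(\<And>u v. g u = g v \<Longrightarrow> f u = f v) \<Longrightarrow> determines g f"
  unfolding determines_def by blast

lemma determinesD: "determines g f \<Longrightarrow> g u = g v \<Longrightarrow> f u = f v"
  unfolding determines_def by blast

lemma pmf_le_cell_prob: "pmf p w \<le> cell_prob p f w"
proof -
  have "pmf p w = (\<Sum>u\<in>{w}. if f u = f w then pmf p u else 0)" by simp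
  also have "\<dots> \<le> cell_prob p f w"
    unfolding cell_prob_def by (rule sum_mono2) auto
  finally show ?thesis .
qed

lemma cell_prob_nonneg: "0 \<le> cell_prob p f w"
  unfolding cell_prob_def by (rule sum_nonneg) auto

lemma cell_prob_cong: "f u = f v \<Longrightarrow> cell_prob p f u = cell_prob p f v"
  by (simp add: cell_prob_def)

lemma cell_prob_antimono:
  assumes "determines g f" shows "cell_prob p g w \<le> cell_prob p f w"
  unfolding cell_prob_def
proof (rule sum_mono)
  fix u
  show "(if g u = g w then pmf p u else 0) \<le> (if f u = f w then pmf p u else 0)"
    using determinesD[OF assms, of u w] by simp
qed

lemma ent_mono:
  assumes "determines g f" shows "ent p f \<le> ent p g"
proof -
  have "pmf p w * log 2 (cell_prob p g w) \<le> pmf p w * log 2 (cell_prob p f w)" for w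
  proof (cases "pmf p w = 0")
    case False
    then have "0 < pmf p w" by (simp add: pmf_nonneg order.not_eq_order_implies_strict)
    then have "0 < cell_prob p g w"
      by (rule less_le_trans[OF _ pmf_le_cell_prob])
    then have "log 2 (cell_prob p g w) \<le> log 2 (cell_prob p f w)"
      by (intro log_mono cell_prob_antimono assms) auto
    then show ?thesis by (simp add: mult_left_mono)
  qed simp
  then show ?thesis
    unfolding ent_def by (simp add: sum_mono)
qed

lemma ent_cong:
  assumes "determines f g" "determines g f" shows "ent p f = ent p g"
  using ent_mono[OF assms(1), of p] ent_mono[OF assms(2), of p] by simp

text \<open>The exponential form of submodularity. Expand the two masses in the numerator as sums
  over points \<open>u\<close> and \<open>v\<close>: the points \<open>w\<close> that share
  \<open>A\<close> with \<open>u\<close> and \<open>B\<close> with \<open>v\<close> lie in one cell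
  of \<open>D\<close>, whose mass cancels. What is left is the sum over \<open>v\<close> of the mass
  of the \<open>C\<close>-cell of \<open>u\<close> divided by itself.\<close>

lemma cell_prob_product_bound:
  assumes AC: "determines A C" and BC: "determines B C"
    and D: "\<And>u v. A u = A v \<Longrightarrow> B u = B v \<Longrightarrow> D u = D v"
  shows "(\<Sum>w\<in>UNIV. pmf p w *
     (cell_prob p A w * cell_prob p B w / (cell_prob p D w * cell_prob p C w))) \<le> 1"
proof -
  define AB where "AB w = (A w, B w)" for w
  define N where "N w = cell_prob p D w * cell_prob p C w" for w
  have inner: "(\<Sum>w\<in>UNIV. pmf p w * (if A u = A w then 1 else 0) * (if B v = B w then 1 else 0) / N w)
      \<le> (if C u = C v then 1 / cell_prob p C u else 0)" (is "?L \<le> ?R") for u v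
  proof (cases "\<exists>w. A w = A u \<and> B w = B v")
    case False
    then have "?L = 0" by (intro sum.neutral) (auto dest: sym)
    then show ?thesis by (auto intro: cell_prob_nonneg)
  next
    case True
    then obtain w0 where w0: "A w0 = A u" "B w0 = B v" by blast
    have Cu: "C u = C v" using w0 AC BC unfolding determines_def by metis
    have "?L = (\<Sum>w\<in>UNIV. (if AB w = AB w0 then pmf p w else 0) / (cell_prob p D w0 * cell_prob p C u))"
    proof (rule sum.cong)
      fix w
      have "N w = cell_prob p D w0 * cell_prob p C u" if "A u = A w" "B v = B w"
        using that w0 D[of w w0] AC cell_prob_cong[of D w w0 p] cell_prob_cong[of C w u p]
        unfolding N_def determines_def by metis
      then show "pmf p w * (if A u = A w then 1 else 0) * (if B v = B w then 1 else 0) / N w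
        = (if AB w = AB w0 then pmf p w else 0) / (cell_prob p D w0 * cell_prob p C u)"
        using w0 by (auto simp: AB_def)
    qed simp
    also have "\<dots> = cell_prob p AB w0 / (cell_prob p D w0 * cell_prob p C u)"
      by (simp add: cell_prob_def sum_divide_distrib)
    also have "\<dots> \<le> cell_prob p D w0 / (cell_prob p D w0 * cell_prob p C u)"
      by (intro divide_right_mono cell_prob_antimono mult_nonneg_nonneg cell_prob_nonneg determinesI D)
        (auto simp: AB_def)
    also have "\<dots> \<le> 1 / cell_prob p C u"
      using cell_prob_nonneg[of p C u] by (cases "cell_prob p D w0 = 0") auto
    finally show ?thesis using Cu by simp
  qed
  have "pmf p w * (cell_prob p A w * cell_prob p B w / N w) =
     (\<Sum>u\<in>UNIV. \<Sum>v\<in>UNIV. pmf p u * pmf p v *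
        (pmf p w * (if A u = A w then 1 else 0) * (if B v = B w then 1 else 0) / N w))" for w
  proof -
    have 1: "cell_prob p A w = (\<Sum>u\<in>UNIV. pmf p u * (if A u = A w then 1 else 0))"
      and 2: "cell_prob p B w = (\<Sum>u\<in>UNIV. pmf p u * (if B u = B w then 1 else 0))"
      unfolding cell_prob_def by (rule sum.cong; simp)+
    have "pmf p w * (cell_prob p A w * cell_prob p B w / N w) = 
       (pmf p w / N w) * (cell_prob p A w * cell_prob p B w)" by simp
    also have "\<dots> = (\<Sum>u\<in>UNIV. \<Sum>v\<in>UNIV. (pmf p w / N w) *
        (pmf p u * (if A u = A w then 1 else 0) * (pmf p v * (if B v = B w then 1 else 0))))"
      unfolding 1 2 sum_product by (simp only: sum_distrib_left)
    finally show ?thesis by (simp only: mult_ac times_divide_eq_left times_divide_eq_right)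
  qed
  then have "(\<Sum>w\<in>UNIV. pmf p w * (cell_prob p A w * cell_prob p B w / N w)) =
     (\<Sum>w\<in>UNIV. \<Sum>u\<in>UNIV. \<Sum>v\<in>UNIV. pmf p u * pmf p v *
        (pmf p w * (if A u = A w then 1 else 0) * (if B v = B w then 1 else 0) / N w))"
    by (simp only:)
  also have "\<dots> = (\<Sum>u\<in>UNIV. \<Sum>w\<in>UNIV. \<Sum>v\<in>UNIV. pmf p u * pmf p v *
        (pmf p w * (if A u = A w then 1 else 0) * (if B v = B w then 1 else 0) / N w))"
    by (rule sum.swap)
  also have "\<dots> = (\<Sum>u\<in>UNIV. \<Sum>v\<in>UNIV. \<Sum>w\<in>UNIV. pmf p u * pmf p v *
        (pmf p w * (if A u = A w then 1 else 0) * (if B v = B w then 1 else 0) / N w))"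
    by (rule sum.cong[OF refl], rule sum.swap)
  also have "\<dots> \<le> (\<Sum>u\<in>UNIV. \<Sum>v\<in>UNIV. pmf p u * pmf p v *
        (if C u = C v then 1 / cell_prob p C u else 0))"
    unfolding sum_distrib_left[symmetric]
    by (intro sum_mono mult_left_mono inner) auto
  also have "\<dots> = (\<Sum>u\<in>UNIV. pmf p u * (cell_prob p C u / cell_prob p C u))"
  proof (rule sum.cong)
    fix u
    have "cell_prob p C u = (\<Sum>v\<in>UNIV. if C u = C v then pmf p v else 0)"
      unfolding cell_prob_def by (rule sum.cong) auto
    then have "pmf p u * (cell_prob p C u / cell_prob p C u) =
        (\<Sum>v\<in>UNIV. pmf p u * ((if C u = C v then pmf p v else 0) / cell_prob p C u))"
      by (metis sum_divide_distrib sum_distrib_left)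
    also have "\<dots> = (\<Sum>v\<in>UNIV. pmf p u * pmf p v * (if C u = C v then 1 / cell_prob p C u else 0))"
      by (rule sum.cong) auto
    finally show "(\<Sum>v\<in>UNIV. pmf p u * pmf p v * (if C u = C v then 1 / cell_prob p C u else 0))
      = pmf p u * (cell_prob p C u / cell_prob p C u)" ..
  qed simp
  \<comment> \<open>The quotient is 1, or 0 if the cell is null, since division by zero yields
    0.\<close>
  also have "\<dots> \<le> (\<Sum>u\<in>UNIV. pmf p u * 1)"
    by (intro sum_mono mult_left_mono) auto
  also have "\<dots> = 1"
    by (simp add: sum_pmf_eq_1)
  finally show ?thesis by (simp add: N_def)
qed

text \<open>By \<open>ln t \<le> t - 1\<close>, the expected log of the ratio is at most its
  expectation minus 1, which \<open>cell_prob_product_bound\<close> makes nonpositive. All later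
  entropy inequalities are instances of this lemma or of \<open>ent_mono\<close>.\<close>

lemma ent_submodular:
  assumes AC: "determines A C" and BC: "determines B C"
    and D: "\<And>u v. A u = A v \<Longrightarrow> B u = B v \<Longrightarrow> D u = D v"
  shows "ent p D + ent p C \<le> ent p A + ent p B"
proof -
  let ?r = "\<lambda>w. cell_prob p A w * cell_prob p B w / (cell_prob p D w * cell_prob p C w)"
  have "pmf p w * (log 2 (cell_prob p A w) + log 2 (cell_prob p B w)
      - log 2 (cell_prob p D w) - log 2 (cell_prob p C w)) \<le> (pmf p w * ?r w - pmf p w) / ln 2" for w
  proof (cases "pmf p w = 0")
    case False
    then have "0 < pmf p w" by (simp add: pmf_nonneg order.not_eq_order_implies_strict)
    have pos: "0 < cell_prob p A w" "0 < cell_prob p B w" "0 < cell_prob p C w" "0 < cell_prob p D w"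
      using \<open>0 < pmf p w\<close> by (auto intro: less_le_trans[OF _ pmf_le_cell_prob])
    then have "log 2 (cell_prob p A w) + log 2 (cell_prob p B w)
      - log 2 (cell_prob p D w) - log 2 (cell_prob p C w) = ln (?r w) / ln 2"
      by (simp add: log_def ln_mult ln_div diff_divide_distrib add_divide_distrib)
    also have "\<dots> \<le> (?r w - 1) / ln 2"
      using pos by (intro divide_right_mono ln_le_minus_one) auto
    finally show ?thesis
      using \<open>0 < pmf p w\<close> by (auto dest: mult_left_mono[of _ _ "pmf p w"] simp: right_diff_distrib)
  qed simp
  then have "(\<Sum>w\<in>UNIV. pmf p w * (log 2 (cell_prob p A w) + log 2 (cell_prob p B w)
      - log 2 (cell_prob p D w) - log 2 (cell_prob p C w))) \<le> (\<Sum>w\<in>UNIV. (pmf p w * ?r w - pmf p w) / ln 2)"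
    by (intro sum_mono)
  also have "\<dots> = ((\<Sum>w\<in>UNIV. pmf p w * ?r w) - 1) / ln 2"
    by (simp add: sum_divide_distrib[symmetric] sum_subtractf sum_pmf_eq_1)
  also have "\<dots> \<le> 0"
    using cell_prob_product_bound[OF AC BC D, where p = p]
    by (intro divide_nonpos_nonneg) auto
  finally show ?thesis
    by (simp add: ent_def algebra_simps sum.distrib sum_subtractf)
qed

text \<open>This is \<open>I(X; (Y, Z)) - I(X; Z)\<close>, the form in which the library defines
  conditional mutual information, after \<open>H(X)\<close> has cancelled.\<close>

definition ent_cmi :: "'w::finite pmf \<Rightarrow> ('w \<Rightarrow> 'a) \<Rightarrow> ('w \<Rightarrow> 'b) \<Rightarrow> ('w \<Rightarrow> 'c) \<Rightarrow> real" where
  "ent_cmi p X Y Z = ent p (\<lambda>w. (Y w, Z w)) - ent p (\<lambda>w. (X w, (Y w, Z w)))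
     - ent p Z + ent p (\<lambda>w. (X w, Z w))"

lemma restrict_eq_iff: "restrict f A = restrict g A \<longleftrightarrow> (\<forall>x\<in>A. f x = g x)"
  by (metis restrict_apply' restrict_ext)

text \<open>Subadditivity of conditional entropy given \<open>Y\<close>, cleared of differences. It
  holds for every joint law; conditional independence given \<open>Y\<close> turns it into an
  equality.\<close>

lemma ent_chain_independent:
  fixes X :: "'w::finite \<Rightarrow> 'k \<Rightarrow> 'x" and Y :: "'w \<Rightarrow> 'y"
  assumes "finite A"
  shows "ent p (\<lambda>w. (restrict (X w) A, Y w)) + (real (card A) - 1) * ent p Y
    \<le> (\<Sum>i\<in>A. ent p (\<lambda>w. (X w i, Y w)))"
  using assms
proof (induction A)
  case empty
  have "ent p (\<lambda>w. (restrict (X w) {}, Y w)) = ent p Y"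
    by (intro ent_cong determinesI) auto
  then show ?case by (simp del: restrict_apply)
next
  case (insert a A)
  have "ent p (\<lambda>w. (restrict (X w) (insert a A), Y w)) + ent p Y
     \<le> ent p (\<lambda>w. (restrict (X w) A, Y w)) + ent p (\<lambda>w. (X w a, Y w))"
    by (rule ent_submodular, (rule determinesI, simp)+) (simp add: restrict_eq_iff)
  then show ?case using insert by (simp add: algebra_simps del: restrict_apply)
qed

text \<open>
  Every message lies in two transcripts.  When player \<open>a\<close> is added to \<open>A\<close>, the messages between
  \<open>a\<close> and \<open>A\<close> are known both from the transcripts of \<open>A\<close> and from that of \<open>a\<close>, and their
  entropy pays for the enlarged set of internal messages.
\<close>
lemma ent_transcripts_ge:
  fixes X :: "'w::finite \<Rightarrow> 'k \<Rightarrow> 'x" and h :: "'w \<Rightarrow> 'k \<Rightarrow> 'k \<Rightarrow> 'c" and W :: "'w \<Rightarrow> 'y"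
  defines "T \<equiv> \<lambda>w i. (\<lambda>j. h w j i, \<lambda>j. h w i j)"
  assumes "finite A" and diag: "\<And>w i. h w i i = e"
  shows "ent p (\<lambda>w. (restrict (X w) A, restrict (T w) A, W w))
       + ent p (\<lambda>w. (restrict (\<lambda>i. restrict (h w i) A) A, W w)) + (real (card A) - 2) * ent p W
    \<le> (\<Sum>i\<in>A. ent p (\<lambda>w. (X w i, T w i, W w)))"
  using assms(2)
proof (induction A)
  case empty
  \<comment> \<open>Without players both joint terms collapse to \<open>ent p W\<close>; the
    coefficient \<open>0 - 2\<close> cancels the two copies.\<close>
  have "ent p (\<lambda>w. (restrict (X w) {}, restrict (T w) {}, W w)) = ent p W"
    "ent p (\<lambda>w. (restrict (\<lambda>i. restrict (h w i) {}) {}, W w)) = ent p W"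
    by (intro ent_cong determinesI; simp add: restrict_def fun_eq_iff)+
  then show ?case by (simp del: restrict_apply)
next
  case (insert a A)
  define C where "C w = (restrict (h w a) A, restrict (\<lambda>i. h w i a) A, W w)" for w
  have "ent p (\<lambda>w. (restrict (X w) (insert a A), restrict (T w) (insert a A), W w)) + ent p C
     \<le> ent p (\<lambda>w. (restrict (X w) A, restrict (T w) A, W w)) + ent p (\<lambda>w. (X w a, T w a, W w))"
  proof (rule ent_submodular)
    show "determines (\<lambda>w. (restrict (X w) A, restrict (T w) A, W w)) C"
      by (rule determinesI) (auto simp: C_def T_def restrict_eq_iff dest: fun_cong)
    show "determines (\<lambda>w. (X w a, T w a, W w)) C"
      by (rule determinesI) (auto simp: C_def T_def restrict_eq_iff dest: fun_cong)
  qed (simp add: restrict_eq_iff)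
  \<comment> \<open>The enlarged block also contains the entry \<open>h w a a\<close>, which neither
    part supplies; \<open>diag\<close> makes it constant. Adding the two inequalities cancels
    \<open>ent p C\<close>.\<close>
  moreover have "ent p (\<lambda>w. (restrict (\<lambda>i. restrict (h w i) (insert a A)) (insert a A), W w)) + ent p W
     \<le> ent p (\<lambda>w. (restrict (\<lambda>i. restrict (h w i) A) A, W w)) + ent p C"
  proof (rule ent_submodular)
    show "determines (\<lambda>w. (restrict (\<lambda>i. restrict (h w i) A) A, W w)) W"
      by (rule determinesI) simp
    show "determines C W"
      by (rule determinesI) (simp add: C_def)
  qed (simp add: restrict_eq_iff C_def diag)
  ultimately show ?case using insert by (simp add: algebra_simps del: restrict_apply)
qed

section \<open>The cost inequality for frozen coins\<close>

lemma ent_cmi_data_processing: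
  assumes "determines Y' Y"
  shows "ent_cmi p X Y Z \<le> ent_cmi p X Y' Z"
proof -
  have "ent p (\<lambda>w. (X w, Y' w, Z w)) + ent p (\<lambda>w. (Y w, Z w))
     \<le> ent p (\<lambda>w. (X w, Y w, Z w)) + ent p (\<lambda>w. (Y' w, Z w))"
  proof (rule ent_submodular)
    show "determines (\<lambda>w. (X w, Y w, Z w)) (\<lambda>w. (Y w, Z w))"
      by (rule determinesI) simp
    show "determines (\<lambda>w. (Y' w, Z w)) (\<lambda>w. (Y w, Z w))"
      by (rule determinesI) (use determinesD[OF assms] in blast)
  qed simp
  then show ?thesis by (simp add: ent_cmi_def)
qed

lemma ent_cond_antimono:
  "ent p (\<lambda>w. (Y w, X w, Z w)) - ent p (\<lambda>w. (X w, Z w)) \<le> ent p (\<lambda>w. (Y w, X w)) - ent p X"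
proof -
  have "ent p (\<lambda>w. (Y w, X w, Z w)) + ent p X \<le> ent p (\<lambda>w. (Y w, X w)) + ent p (\<lambda>w. (X w, Z w))"
    by (rule ent_submodular, (rule determinesI, simp)+) simp
  then show ?thesis by simp
qed

text \<open>\<open>h w i j\<close> stands for what \<open>i\<close> reads from \<open>j\<close>, so
  \<open>T i\<close> pairs what \<open>i\<close> sends with what it reads; one array serves both, as
  everything sent is read. The hypothesis \<open>indep\<close> is conditional independence of the
  inputs given \<open>W\<close>, in entropies.\<close>

lemma switched_cost_le_private_cost:
  fixes X :: "'w::finite \<Rightarrow> 'k::finite \<Rightarrow> 'x" and h :: "'w \<Rightarrow> 'k \<Rightarrow> 'k \<Rightarrow> 'c"
    and M :: "'w \<Rightarrow> 'm" and Z :: "'w \<Rightarrow> 'z"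
  defines "T \<equiv> \<lambda>i w. (\<lambda>j. h w j i, \<lambda>j. h w i j)" and "W \<equiv> \<lambda>w. (M w, Z w)"
  assumes diag: "\<And>w i. h w i i = e"
    and Xh: "determines X h"
    and indep: "(\<Sum>i\<in>UNIV. ent p (\<lambda>w. (X w i, W w)))
       \<le> ent p (\<lambda>w. (X w, W w)) + (real CARD('k) - 1) * ent p W"
  shows "1/2 * (\<Sum>i\<in>UNIV. ent_cmi p (\<lambda>w. X w i) (T i) W + ent_cmi p M (T i) (\<lambda>w. (X w i, Z w)))
    \<le> (\<Sum>i\<in>UNIV. ent_cmi p (\<lambda>w. restrict (X w) (- {i})) (T i) (\<lambda>w. X w i))"
proof -
  define P where "P i = ent p (\<lambda>w. (T i w, X w i)) - ent p (\<lambda>w. X w i)" for i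
  have XT: "T i u = T i v" if "X u = X v" for i u v
    using determinesD[OF Xh that] by (simp add: T_def)
  have restr: "X u = X v" if "restrict (X u) (- {i}) = restrict (X v) (- {i})" "X u i = X v i" for i u v
  proof
    fix j show "X u j = X v j"
      using that by (cases "j = i") (simp_all add: restrict_eq_iff)
  qed
  have pic: "ent_cmi p (\<lambda>w. restrict (X w) (- {i})) (T i) (\<lambda>w. X w i) = P i" for i
  proof -
    \<comment> \<open>All inputs together determine the transcript, so only \<open>P i\<close>, the
      entropy of \<open>T i\<close> given the input of \<open>i\<close>, survives.\<close>
    have "ent p (\<lambda>w. (restrict (X w) (- {i}), T i w, X w i)) = ent p (\<lambda>w. (restrict (X w) (- {i}), X w i))"
      by (intro ent_cong determinesI) (use restr XT in \<open>blast | simp\<close>)+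
    then show ?thesis by (simp add: ent_cmi_def P_def)
  qed
  have M: "ent_cmi p M (T i) (\<lambda>w. (X w i, Z w)) \<le> P i" for i
  proof -
    have "ent p (\<lambda>w. (M w, X w i, Z w)) \<le> ent p (\<lambda>w. (M w, T i w, X w i, Z w))"
      by (rule ent_mono, rule determinesI) simp
    moreover have "ent p (\<lambda>w. (T i w, X w i, Z w)) - ent p (\<lambda>w. (X w i, Z w)) \<le> P i"
      unfolding P_def by (rule ent_cond_antimono)
    ultimately show ?thesis by (simp add: ent_cmi_def)
  qed
  have "(\<Sum>i\<in>UNIV. ent_cmi p (\<lambda>w. X w i) (T i) W) \<le> (\<Sum>i\<in>UNIV. ent_cmi p (\<lambda>w. X w i) h W)"
    by (intro sum_mono ent_cmi_data_processing determinesI) (simp add: T_def)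
  also have "\<dots> = (\<Sum>i\<in>UNIV. ent p (\<lambda>w. (X w i, W w))) - (\<Sum>i\<in>UNIV. ent p (\<lambda>w. (X w i, h w, W w)))
     + real CARD('k) * (ent p (\<lambda>w. (h w, W w)) - ent p W)"
    by (simp add: ent_cmi_def sum.distrib sum_subtractf algebra_simps)
  \<comment> \<open>Independence replaces \<open>\<Sum>\<^sub>i H(X\<^sub>i | W)\<close> by
    \<open>H(X | W)\<close>, and subadditivity given \<open>(h, W)\<close> bounds the subtracted sum
    from below by \<open>H(X | h, W)\<close>. The difference is at most
    \<open>H(h | W)\<close>.\<close>
  also have "\<dots> \<le> ent p (\<lambda>w. (h w, W w)) - ent p W"
  proof -
    have "ent p (\<lambda>w. (X w, W w)) \<le> ent p (\<lambda>w. (restrict (X w) UNIV, h w, W w))"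
      by (intro ent_mono determinesI) (simp add: restrict_UNIV)
    then show ?thesis
      using indep ent_chain_independent[of UNIV p X "\<lambda>w. (h w, W w)"] by (simp add: algebra_simps)
  qed
  \<comment> \<open>The transcript bound carries \<open>k - 2\<close> copies of
    \<open>ent p W\<close> and \<open>indep\<close> carries \<open>k - 1\<close>, which leaves
    exactly the one copy subtracted on the left; the terms for all inputs cancel.\<close>
  also have "\<dots> \<le> (\<Sum>i\<in>UNIV. ent p (\<lambda>w. (X w i, T i w, W w))) - (\<Sum>i\<in>UNIV. ent p (\<lambda>w. (X w i, W w)))"
  proof -
    have "ent p (\<lambda>w. (X w, W w)) \<le> ent p (\<lambda>w. (restrict (X w) UNIV, restrict (\<lambda>i. T i w) UNIV, W w))"
      by (intro ent_mono determinesI) (simp add: restrict_UNIV)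
    moreover have "ent p (\<lambda>w. (restrict (\<lambda>i. restrict (h w i) UNIV) UNIV, W w)) = ent p (\<lambda>w. (h w, W w))"
      by (simp add: restrict_UNIV)
    ultimately show ?thesis
      using indep ent_transcripts_ge[of UNIV h e p X W, OF _ diag] by (simp add: T_def algebra_simps)
  qed
  also have "\<dots> \<le> (\<Sum>i\<in>UNIV. P i)"
    unfolding sum_subtractf[symmetric]
  proof (rule sum_mono)
    fix i
    have "ent p (\<lambda>w. (X w i, T i w, W w)) = ent p (\<lambda>w. (T i w, X w i, W w))"
      by (intro ent_cong determinesI) simp_all
    then show "ent p (\<lambda>w. (X w i, T i w, W w)) - ent p (\<lambda>w. (X w i, W w)) \<le> P i"
      using ent_cond_antimono[of p "T i" "\<lambda>w. X w i" W] by (simp add: P_def)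
  qed
  finally have "(\<Sum>i\<in>UNIV. ent_cmi p (\<lambda>w. X w i) (T i) W) \<le> (\<Sum>i\<in>UNIV. P i)" .
  moreover have "(\<Sum>i\<in>UNIV. ent_cmi p M (T i) (\<lambda>w. (X w i, Z w))) \<le> (\<Sum>i\<in>UNIV. P i)"
    by (intro sum_mono M)
  ultimately show ?thesis by (simp add: pic sum.distrib)
qed

section \<open>Conditional independence under the input distribution\<close>

text \<open>By \<open>bij\<close>, a fibre of \<open>W\<close> contains each input family exactly
  once. The cell is then a box, fixed on \<open>A\<close> and free elsewhere; the sum over a box of
  a product is a product of sums, and the free factors sum to 1.\<close>

lemma cell_prob_product_form:
  fixes p :: "'w::finite pmf" and X :: "'w \<Rightarrow> 'k::finite \<Rightarrow> 'x::finite" and W :: "'w \<Rightarrow> 'y"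
  assumes bij: "bij (\<lambda>w. (X w, W w))"
    and p: "\<And>w. pmf p w = g (W w) * (\<Prod>i\<in>UNIV. F i (X w i) (W w))"
    and F1: "\<And>i y. (\<Sum>a\<in>UNIV. F i a y) = 1"
  shows "cell_prob p (\<lambda>w. (restrict (X w) A, W w)) w = g (W w) * (\<Prod>i\<in>A. F i (X w i) (W w))"
proof -
  define B where "B i = (if i \<in> A then {X w i} else UNIV)" for i
  have inX: "inj_on X {u. W u = W w}"
    using bij by (auto simp: inj_on_def bij_def)
  have "cell_prob p (\<lambda>w. (restrict (X w) A, W w)) w
      = (\<Sum>u | W u = W w. if X u \<in> PiE UNIV B then g (W w) * (\<Prod>i\<in>UNIV. F i (X u i) (W w)) else 0)"
  proof -
    have "restrict (X u) A = restrict (X w) A \<longleftrightarrow> X u \<in> PiE UNIV B" for u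
      by (auto simp: restrict_eq_iff B_def PiE_def Pi_def)
    then show ?thesis
      unfolding cell_prob_def by (intro sum.mono_neutral_cong_right) (auto simp: p)
  qed
  also have "\<dots> = (\<Sum>x\<in>X ` {u. W u = W w}. if x \<in> PiE UNIV B then g (W w) * (\<Prod>i\<in>UNIV. F i (x i) (W w)) else 0)"
    using inX by (simp add: sum.reindex)
  also have "X ` {u. W u = W w} = UNIV"
  proof -
    have "\<exists>u. X u = x \<and> W u = W w" for x
      using bij by (metis (mono_tags, lifting) bij_def Pair_inject surjD)
    then show ?thesis by (auto simp: image_def) metis
  qed
  also have "(\<Sum>x\<in>UNIV. if x \<in> PiE UNIV B then g (W w) * (\<Prod>i\<in>UNIV. F i (x i) (W w)) else 0)
     = g (W w) * (\<Sum>x\<in>PiE UNIV B. \<Prod>i\<in>UNIV. F i (x i) (W w))"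
    by (simp add: sum_distrib_left sum.If_cases)
  also have "(\<Sum>x\<in>PiE UNIV B. \<Prod>i\<in>UNIV. F i (x i) (W w)) = (\<Prod>i\<in>UNIV. \<Sum>a\<in>B i. F i a (W w))"
    by (rule prod_sum_PiE[symmetric]) auto
  also have "\<dots> = (\<Prod>i\<in>A. F i (X w i) (W w))"
    by (rule prod.mono_neutral_cong_right) (auto simp: B_def F1)
  finally show ?thesis .
qed

text \<open>The log of a product makes \<open>ent p (\<lambda>w. (restrict (X w) A, W w))\<close>
  affine in the players of \<open>A\<close>. Comparing \<open>A\<close> a singleton, empty and
  everything gives the identity.\<close>

lemma ent_product_form:
  fixes p :: "'w::finite pmf" and X :: "'w \<Rightarrow> 'k::finite \<Rightarrow> 'x::finite" and W :: "'w \<Rightarrow> 'y"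
  assumes bij: "bij (\<lambda>w. (X w, W w))"
    and p: "\<And>w. pmf p w = g (W w) * (\<Prod>i\<in>UNIV. F i (X w i) (W w))"
    and F1: "\<And>i y. (\<Sum>a\<in>UNIV. F i a y) = 1"
    and nonneg: "\<And>y. 0 \<le> g y" "\<And>i a y. 0 \<le> F i a y"
  shows "(\<Sum>i\<in>UNIV. ent p (\<lambda>w. (X w i, W w)))
    = ent p (\<lambda>w. (X w, W w)) + (real CARD('k) - 1) * ent p W"
proof -
  define G where "G = (\<Sum>w\<in>UNIV. pmf p w * log 2 (g (W w)))"
  define L where "L i = (\<Sum>w\<in>UNIV. pmf p w * log 2 (F i (X w i) (W w)))" for i
  have ent: "ent p (\<lambda>w. (restrict (X w) A, W w)) = - G - (\<Sum>i\<in>A. L i)" for A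
  proof -
    have "pmf p w * log 2 (cell_prob p (\<lambda>w. (restrict (X w) A, W w)) w)
       = pmf p w * log 2 (g (W w)) + (\<Sum>i\<in>A. pmf p w * log 2 (F i (X w i) (W w)))" for w
    proof (cases "pmf p w = 0")
      case False
      then have nz: "g (W w) \<noteq> 0" "\<And>i. F i (X w i) (W w) \<noteq> 0"
        using p[of w] by auto
      then have "0 < g (W w)" "\<And>i. 0 < F i (X w i) (W w)"
        using nonneg by (auto simp: less_le)
      then have "log 2 (g (W w) * (\<Prod>i\<in>A. F i (X w i) (W w)))
          = log 2 (g (W w)) + (\<Sum>i\<in>A. log 2 (F i (X w i) (W w)))"
        by (simp add: log_mult_pos prod_pos)
          (simp add: log_def ln_prod nz sum_divide_distrib)
      then show ?thesis
        unfolding cell_prob_product_form[where g = g and F = F, OF bij p F1]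
        by (simp only: distrib_left sum_distrib_left)
    qed simp
    then show ?thesis
      unfolding ent_def G_def L_def by (simp add: sum.distrib sum.swap[of _ A])
  qed
  have 1: "ent p (\<lambda>w. (X w i, W w)) = - G - L i" for i
  proof -
    have "ent p (\<lambda>w. (X w i, W w)) = ent p (\<lambda>w. (restrict (X w) {i}, W w))"
      by (intro ent_cong determinesI) (simp_all add: restrict_eq_iff)
    then show ?thesis using ent[of "{i}"] by simp
  qed
  have 2: "ent p W = - G"
  proof -
    have "ent p W = ent p (\<lambda>w. (restrict (X w) {}, W w))"
      by (intro ent_cong determinesI) (simp_all add: restrict_eq_iff)
    then show ?thesis using ent[of "{}"] by simp
  qed
  have 3: "ent p (\<lambda>w. (X w, W w)) = - G - (\<Sum>i\<in>UNIV. L i)"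
    using ent[of UNIV] by (simp add: restrict_UNIV)
  show ?thesis
    unfolding 1 2 3 by (simp add: sum_subtractf algebra_simps)
qed

lemma pmf_bind_finite:
  fixes N :: "'a::finite pmf"
  shows "pmf (bind_pmf N f) b = (\<Sum>a\<in>UNIV. pmf N a * pmf (f a) b)"
  by (simp add: pmf_bind integral_measure_pmf_real[where A = UNIV] mult.commute)

text \<open>The conditional law of the bit of player \<open>i\<close> given \<open>M = m\<close> and \<open>Z = z\<close>.\<close>
definition mu_bit :: "'k \<Rightarrow> bool \<Rightarrow> bool \<times> 'k \<Rightarrow> real" where
  "mu_bit i b = (\<lambda>(m, z). if i = z then of_bool (\<not> b) else if m then of_bool b else 1/2)"

lemma card_zero_at: "card {x::'k::finite \<Rightarrow> bool. \<not> x z} = 2 ^ (CARD('k) - 1)"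
proof -
  have "{x. \<not> x z} = PiE UNIV (\<lambda>i. if i = z then {False} else UNIV)"
    by (auto simp: PiE_def Pi_def split: if_splits)
  then have "card {x. \<not> x z} = (\<Prod>i\<in>UNIV. card (if i = z then {False} else UNIV))"
    by (simp add: card_PiE)
  also have "\<dots> = (\<Prod>i\<in>UNIV - {z}. 2)"
    by (rule prod.mono_neutral_cong_right) auto
  finally show ?thesis by simp
qed

text \<open>Shows that the bits are independent given \<open>(m, z)\<close>: the point mass for
  \<open>m\<close> true and the uniform law on the vectors with a zero at \<open>z\<close> are both
  products over the players.\<close>

lemma pmf_mu:
  fixes x :: "'k::finite \<Rightarrow> bool"
  shows "pmf mu (x, m, z) = (if m then 1/3 else 2/3) / CARD('k) * (\<Prod>i\<in>UNIV. mu_bit i (x i) (m, z))"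
proof -
  define Q where "Q m z = (if m then return_pmf (\<lambda>i. i \<noteq> z) else pmf_of_set {x. \<not> x z})" for m and z :: 'k
  have "pmf mu (x, m, z) = (\<Sum>m'\<in>UNIV. \<Sum>z'\<in>UNIV. \<Sum>x'\<in>UNIV.
      if x = x' then if z = z' then if m = m' then
        pmf (bernoulli_pmf (1/3)) m' * pmf (pmf_of_set UNIV) z' * pmf (Q m' z') x' else 0 else 0 else 0)"
    unfolding mu_def Q_def[symmetric] pmf_bind_finite sum_distrib_left
    by (intro sum.cong refl) (auto simp: mult_ac pmf_return)
  also have "\<dots> = pmf (bernoulli_pmf (1/3)) m * pmf (pmf_of_set UNIV) z * pmf (Q m z) x"
    by simp
  also have "pmf (Q m z) x = (\<Prod>i\<in>UNIV. mu_bit i (x i) (m, z))"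
  proof (cases m)
    case True
    have "(\<Prod>i\<in>UNIV. mu_bit i (x i) (m, z)) = (\<Prod>i\<in>UNIV. of_bool (x i = (i \<noteq> z)))"
      using True by (intro prod.cong) (auto simp: mu_bit_def)
    also have "\<dots> = of_bool (x = (\<lambda>i. i \<noteq> z))"
      by (auto simp: fun_eq_iff)
    finally show ?thesis using True by (simp add: Q_def pmf_return)
  next
    case False
    have "(\<Prod>i\<in>UNIV. mu_bit i (x i) (m, z)) = of_bool (\<not> x z) * (\<Prod>i\<in>UNIV - {z}. 1/2)"
      using False by (subst prod.remove[of _ z]) (auto simp: mu_bit_def intro!: prod.cong)
    moreover have "{x. \<not> x z} \<noteq> {}" by (auto intro: exI[of _ "\<lambda>_. False"])
    ultimately show ?thesis using False
      by (simp add: Q_def card_zero_at power_one_over indicator_def)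
  qed
  finally show ?thesis by simp
qed

text \<open>The mass of a sample is a product over coordinates and, by \<open>pmf_mu\<close>, over
  players. Exchanging the two products gives one factor per player, as
  \<open>ent_product_form\<close> asks.\<close>

lemma ent_mu_n:
  fixes X :: "('n::finite \<Rightarrow> ('k::finite \<Rightarrow> bool) \<times> bool \<times> 'k) \<Rightarrow> 'k \<Rightarrow> 'n \<Rightarrow> bool" and M Z
  defines "X \<equiv> \<lambda>w i t. fst (w t) i" and "M \<equiv> \<lambda>w t. fst (snd (w t))" and "Z \<equiv> \<lambda>w t. snd (snd (w t))"
  shows "(\<Sum>i\<in>UNIV. ent mu_n (\<lambda>w. (X w i, M w, Z w)))
    = ent mu_n (\<lambda>w. (X w, M w, Z w)) + (real CARD('k) - 1) * ent mu_n (\<lambda>w. (M w, Z w))"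
proof (rule ent_product_form)
  let ?g = "\<lambda>(m, z :: 'n \<Rightarrow> 'k). \<Prod>t\<in>UNIV. (if m t then 1/3 else 2/3) / real CARD('k)"
  let ?F = "\<lambda>i (a :: 'n \<Rightarrow> bool) (m, z). \<Prod>t\<in>UNIV. mu_bit i (a t) (m t, z t)"
  show "bij (\<lambda>w. (X w, M w, Z w))"
  proof (rule bij_betw_byWitness[where f' = "\<lambda>(x, m, z) t. (\<lambda>i. x i t, m t, z t)"])
  qed (auto simp: X_def M_def Z_def)
  show "pmf mu_n w = ?g (M w, Z w) * (\<Prod>i\<in>UNIV. ?F i (X w i) (M w, Z w))" for w
  proof -
    have "pmf mu_n w = (\<Prod>t\<in>UNIV. pmf mu (\<lambda>i. X w i t, M w t, Z w t))"
      unfolding mu_n_def by (subst pmf_Pi) (auto simp: X_def M_def Z_def)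
    also have "\<dots> = (\<Prod>t\<in>UNIV. (if M w t then 1/3 else 2/3) / real CARD('k)) *
        (\<Prod>t\<in>UNIV. \<Prod>i\<in>UNIV. mu_bit i (X w i t) (M w t, Z w t))"
      unfolding pmf_mu prod.distrib ..
    also have "(\<Prod>t\<in>UNIV. \<Prod>i\<in>UNIV. mu_bit i (X w i t) (M w t, Z w t))
        = (\<Prod>i\<in>UNIV. \<Prod>t\<in>UNIV. mu_bit i (X w i t) (M w t, Z w t))"
      by (rule prod.swap)
    finally show ?thesis by simp
  qed
  show "(\<Sum>a\<in>UNIV. ?F i a y) = 1" for i y
  proof -
    obtain m z where y: "y = (m, z)" by force
    have "(\<Sum>a\<in>UNIV. ?F i a y) = (\<Sum>a\<in>PiE UNIV (\<lambda>_. UNIV). \<Prod>t\<in>UNIV. mu_bit i (a t) (m t, z t))"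
      by (simp add: y)
    also have "\<dots> = (\<Prod>t\<in>UNIV. \<Sum>b\<in>UNIV. mu_bit i b (m t, z t))"
      by (rule prod_sum_PiE[symmetric]) auto
    also have "\<dots> = 1"
      by (auto simp: mu_bit_def UNIV_bool intro!: prod.neutral)
    finally show ?thesis .
  qed
qed (auto simp: mu_bit_def intro!: prod_nonneg)

section \<open>Transcripts of proper synchronous executions\<close>

text \<open>
  The messages that \<open>i\<close> has read from \<open>j\<close> by the end of local round \<open>t\<close>, in an execution in which
  everybody sends to and reads from everybody else in each of the rounds \<open>1, \<dots>, t\<close>.
\<close>
fun hist :: "('k, 'x, 'r, 's) protocol \<Rightarrow> ('k \<Rightarrow> 'x) \<Rightarrow> ('k \<Rightarrow> 'r) \<Rightarrow> 's \<Rightarrow> nat \<Rightarrow> 'k \<Rightarrow> 'k \<Rightarrow> msg list" where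
  "hist \<pi> x r s 0 = (\<lambda>i j. [])"
| "hist \<pi> x r s (Suc t) = (\<lambda>i j. if i = j then [] else
     hist \<pi> x r s t i j @ [the (send \<pi> j (Suc t) (x j, r j, s, hist \<pi> x r s t j) i)])"

lemma hist_self [simp]: "hist \<pi> x r s t i i = []"
  by (cases t) auto

lemma length_hist: "i \<noteq> j \<Longrightarrow> length (hist \<pi> x r s t i j) = t"
  by (induction t) auto

text \<open>The lockstep schedule after \<open>t\<close> complete rounds, hence
  \<open>lround = Suc t\<close>. Everything sent has been read, so \<open>sent\<close> is the
  transpose of \<open>got\<close>. One schedule is enough, by \<open>final_unique\<close>.\<close>

definition ready_state :: "('k, 'x, 'r, 's) protocol \<Rightarrow> ('k \<Rightarrow> 'x) \<Rightarrow> ('k \<Rightarrow> 'r) \<Rightarrow> 's \<Rightarrow> nat \<Rightarrow> 'k config" where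
  "ready_state \<pi> x r s t i =
     \<lparr>lround = Suc t, phase = Ready, sent = (\<lambda>j. hist \<pi> x r s t j i), got = hist \<pi> x r s t i\<rparr>"

definition waiting_state ::
  "('k, 'x, 'r, 's) protocol \<Rightarrow> ('k \<Rightarrow> 'x) \<Rightarrow> ('k \<Rightarrow> 'r) \<Rightarrow> 's \<Rightarrow> nat \<Rightarrow> 'k set \<Rightarrow> 'k config" where
  "waiting_state \<pi> x r s t W i =
     \<lparr>lround = Suc t, phase = Waiting W, sent = (\<lambda>j. hist \<pi> x r s (Suc t) j i),
      got = (\<lambda>j. if j \<in> W then hist \<pi> x r s t i j else hist \<pi> x r s (Suc t) i j)\<rparr>"

lemma reachable_move:
  assumes "reachable \<pi> x r s c" "move \<pi> x r s c i p"
  shows "reachable \<pi> x r s (c(i := p))"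
proof -
  have "step \<pi> x r s c (c(i := p))"
    using assms(2) unfolding step_def by blast
  with assms(1) show ?thesis
    unfolding reachable_def by auto
qed

text \<open>Turns one-player moves into a simultaneous move of all: the players of \<open>A\<close>
  are already in their new state, and \<open>A\<close> grows one player at a time.\<close>

lemma reachable_all_players:
  fixes c d :: "('k::finite) config"
  assumes "reachable \<pi> x r s c"
    and step: "\<And>A i. i \<notin> A \<Longrightarrow> reachable \<pi> x r s (\<lambda>j. if j \<in> A then d j else c j) \<Longrightarrow>
      reachable \<pi> x r s ((\<lambda>j. if j \<in> A then d j else c j)(i := d i))"
  shows "reachable \<pi> x r s d"
proof -
  have "reachable \<pi> x r s (\<lambda>j. if j \<in> A then d j else c j)" for A
  proof (induction A rule: finite_induct[OF finite])
    case 1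
    then show ?case using assms(1) by simp
  next
    case (2 i A)
    have "(\<lambda>j. if j \<in> insert i A then d j else c j) = (\<lambda>j. if j \<in> A then d j else c j)(i := d i)"
      by auto
    then show ?case using step[OF 2(2,3)] by simp
  qed
  from this[of UNIV] show ?thesis by simp
qed

section \<open>The lockstep execution, round by round\<close>

context
  fixes \<pi> :: "('k::finite, 'x, 'r, 's) protocol" and x r s tf
  assumes valid: "valid_protocol \<pi>"
    and r: "r \<in> space (PiM UNIV (priv_coins \<pi>))" and s: "s \<in> space (pub_coins \<pi>)"
    and proper: "\<And>c i t v. reachable \<pi> x r s c \<Longrightarrow> phase (c i) = Ready \<Longrightarrow>
        t = lround (c i) \<Longrightarrow> v = view_of x r s c i \<Longrightarrow>
          (t < tf \<longrightarrow> (\<forall>j. j \<noteq> i \<longrightarrow> send \<pi> i t v j \<noteq> None) \<and>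
             decide \<pi> i t v = None \<and> await \<pi> i t v = - {i}) \<and>
          (t = tf \<longrightarrow> (\<forall>j. send \<pi> i t v j = None) \<and> decide \<pi> i t v \<noteq> None)"
begin

private abbreviation "H \<equiv> hist \<pi> x r s"
private abbreviation "rdy \<equiv> ready_state \<pi> x r s"
private abbreviation "wtg \<equiv> waiting_state \<pi> x r s"
private abbreviation "reach \<equiv> reachable \<pi> x r s"

lemma send_self: "l \<ge> 1 \<Longrightarrow> send \<pi> i l (x i, r i, s, h) i = None"
proof -
  assume "l \<ge> 1"
  moreover have "(x i, r i, s, h) \<in> space (view_space \<pi> i)"
    using r s by (auto simp: view_space_def space_pair_measure space_PiM)
  ultimately show ?thesis using valid unfolding valid_protocol_def by blast
qed

lemma reachable_begin:
  assumes "Suc t < tf" "reach (rdy t)"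
  shows "reach (\<lambda>i. wtg t (- {i}) i)"
proof (rule reachable_all_players[OF assms(2)])
  fix A i
  let ?c = "\<lambda>j. if j \<in> A then wtg t (- {j}) j else rdy t j"
  assume i: "i \<notin> A" and c: "reach ?c"
  let ?v = "view_of x r s ?c i"
  have v: "?v = (x i, r i, s, H t i)"
    using i by (simp add: view_of_def ready_state_def)
  have ready: "phase (?c i) = Ready" "Suc t = lround (?c i)"
    using i by (simp_all add: ready_state_def)
  have *: "(\<forall>j. j \<noteq> i \<longrightarrow> send \<pi> i (Suc t) ?v j \<noteq> None) \<and>
             decide \<pi> i (Suc t) ?v = None \<and> await \<pi> i (Suc t) ?v = - {i}"
    using proper[OF c ready(1) ready(2) refl] assms(1) by blast
  have "begin_round \<pi> i ?v (?c i) = wtg t (- {i}) i"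
  proof -
    have "H t j i @ (case send \<pi> i (Suc t) ?v j of None \<Rightarrow> [] | Some m \<Rightarrow> [m]) = H (Suc t) j i" for j
    proof (cases "j = i")
      case True
      then show ?thesis using send_self[of "Suc t" i] by (simp add: v)
    next
      case False
      then obtain m where "send \<pi> i (Suc t) ?v j = Some m" using * by blast
      then show ?thesis using False by (simp add: v)
    qed
    moreover have "H t i = (\<lambda>j. if j \<in> - {i} then H t i j else H (Suc t) i j)"
      by auto
    ultimately show ?thesis
      using * i by (simp add: begin_round_def waiting_state_def ready_state_def del: hist.simps)
  qed
  moreover have "move \<pi> x r s ?c i (begin_round \<pi> i ?v (?c i))"
    by (rule begin_move) (use i in \<open>simp add: ready_state_def\<close>)
  ultimately show "reach (?c(i := wtg t (- {i}) i))"
    using reachable_move[OF c, of i] by simp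
qed

text \<open>Induction on the players still to be read from. All of them have sent their message of
  round \<open>Suc t\<close>, and \<open>i\<close> has read only \<open>t\<close> messages from
  each, so every read is enabled and fetches that message.\<close>

lemma reachable_read_one:
  assumes "finite W" "i \<notin> W" "reach c" "c i = wtg t W i"
    and "\<And>j. j \<noteq> i \<Longrightarrow> sent (c j) i = H (Suc t) i j"
  shows "reach (c(i := wtg t {} i))"
  using assms
proof (induction W arbitrary: c rule: finite_induct)
  case empty
  then have "c(i := wtg t {} i) = c" by (simp add: fun_eq_iff)
  then show ?case using empty by simp
next
  case (insert a W)
  have "a \<noteq> i" using insert.prems by auto
  let ?p = "(c i)\<lparr>phase := Waiting (insert a W - {a}),
        got := (got (c i))(a := got (c i) a @ [sent (c a) i ! length (got (c i) a)])\<rparr>"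
  have m: "move \<pi> x r s c i ?p"
    by (rule read_move) (use insert.prems(3,4) \<open>a \<noteq> i\<close> in \<open>auto simp: waiting_state_def length_hist\<close>)
  have "(\<lambda>j. if j \<in> insert a W then H t i j else H (Suc t) i j)
       (a := H t i a @ [H (Suc t) i a ! length (H t i a)])
     = (\<lambda>j. if j \<in> W then H t i j else H (Suc t) i j)"
    using insert.hyps \<open>a \<noteq> i\<close> by (auto simp: fun_eq_iff)
  then have p: "?p = wtg t W i"
    using insert.hyps insert.prems(4)[OF \<open>a \<noteq> i\<close>] insert.prems(3)
    by (simp add: waiting_state_def del: hist.simps)
  have "reach ((c(i := ?p))(i := wtg t {} i))"
    by (rule insert.IH)
      (use insert.prems p reachable_move[OF insert.prems(2) m] in \<open>simp_all del: hist.simps fun_upd_apply, simp_all\<close>)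
  then show ?case by (simp only: fun_upd_upd)
qed

lemma reachable_read:
  assumes "reach (\<lambda>i. wtg t (- {i}) i)"
  shows "reach (wtg t {})"
proof (rule reachable_all_players[OF assms])
  fix A i
  let ?c = "\<lambda>j. if j \<in> A then wtg t {} j else wtg t (- {j}) j"
  assume i: "i \<notin> A" and c: "reach ?c"
  show "reach (?c(i := wtg t {} i))"
    by (rule reachable_read_one[OF _ _ c, of "- {i}"]) (use i in \<open>auto simp: waiting_state_def\<close>)
qed

lemma reachable_end:
  assumes "reach (wtg t {})"
  shows "reach (rdy (Suc t))"
proof (rule reachable_all_players[OF assms])
  fix A i
  let ?c = "\<lambda>j. if j \<in> A then rdy (Suc t) j else wtg t {} j"
  assume i: "i \<notin> A" and c: "reach ?c"
  have "move \<pi> x r s ?c i ((?c i)\<lparr>lround := Suc (lround (?c i)), phase := Ready\<rparr>)"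
    by (rule end_move) (use i in \<open>simp add: waiting_state_def\<close>)
  moreover have "(?c i)\<lparr>lround := Suc (lround (?c i)), phase := Ready\<rparr> = rdy (Suc t) i"
    using i by (simp add: waiting_state_def ready_state_def del: hist.simps)
  ultimately show "reach (?c(i := rdy (Suc t) i))"
    using reachable_move[OF c, of i] by simp
qed

lemma reachable_ready: "t < tf \<Longrightarrow> reach (rdy t)"
proof (induction t)
  case 0
  have "rdy 0 = initial"
    by (simp add: initial_def ready_state_def fun_eq_iff)
  then show ?case by (simp add: reachable_def)
next
  case (Suc t)
  then show ?case
    by (intro reachable_end reachable_read reachable_begin) simp_all
qed

text \<open>After \<open>t\<close> lockstep rounds everybody stops without sending, and no move is
  left. The final configuration is unique, so this execution gives the transcript, and its sent and
  read messages form the same array.\<close>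

lemma transcript_eq_hist:
  assumes "tf = Suc t"
  shows "transcript \<pi> x r s i = (\<lambda>j. H t j i, H t i)"
proof -
  have rdy: "reach (rdy t)" by (rule reachable_ready) (simp add: assms)
  define y where "y i = the (decide \<pi> i tf (x i, r i, s, H t i))" for i
  define d where "d i = (rdy t i)\<lparr>phase := Stopped (y i)\<rparr>" for i
  have "reach d"
  proof (rule reachable_all_players[OF rdy])
    fix A i
    let ?c = "\<lambda>j. if j \<in> A then d j else rdy t j"
    assume i: "i \<notin> A" and c: "reach ?c"
    let ?v = "view_of x r s ?c i"
    have v: "?v = (x i, r i, s, H t i)"
      using i by (simp add: view_of_def ready_state_def)
    have ready: "phase (?c i) = Ready" "tf = lround (?c i)"
      using i assms by (simp_all add: ready_state_def)
    have *: "(\<forall>j. send \<pi> i tf ?v j = None) \<and> decide \<pi> i tf ?v \<noteq> None"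
      using proper[OF c ready(1) ready(2) refl] by blast
    then have "decide \<pi> i tf ?v = Some (y i)" by (auto simp: v y_def)
    then have "begin_round \<pi> i ?v (?c i) = d i"
      using * i assms by (simp add: begin_round_def d_def ready_state_def)
    moreover have "move \<pi> x r s ?c i (begin_round \<pi> i ?v (?c i))"
      by (rule begin_move) (use i in \<open>simp add: ready_state_def\<close>)
    ultimately show "reach (?c(i := d i))"
      using reachable_move[OF c, of i] by simp
  qed
  moreover have "\<not> step \<pi> x r s d c'" for c'
    unfolding step_def by (auto elim!: move.cases simp: d_def)
  ultimately have fin: "final \<pi> x r s d"
    by (simp add: final_def)
  have "final_config \<pi> x r s = d"
    unfolding final_config_def by (rule the_equality, rule fin, erule final_unique, rule fin)
  then show ?thesis
    by (simp add: transcript_def d_def ready_state_def)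
qed

end

text \<open>Lets the private strings be replaced by one fixed choice, so that the messages depend on
  the inputs and the public string alone.\<close>

lemma hist_public_coins:
  assumes "public_coins_protocol \<pi>"
    and "r \<in> space (PiM UNIV (priv_coins \<pi>))" "r' \<in> space (PiM UNIV (priv_coins \<pi>))"
  shows "hist \<pi> x r s t = hist \<pi> x r' s t"
proof (induction t)
  case (Suc t)
  have "send \<pi> j (Suc t) (x j, r j, s, h) = send \<pi> j (Suc t) (x j, r' j, s, h)" for j h
    using assms unfolding public_coins_protocol_def space_PiM by (auto simp: PiE_def Pi_def)
  then show ?case by (simp only: hist.simps Suc)
qed simp

lemma measurable_fun_count_space:
  fixes f :: "'a \<Rightarrow> 'i::finite \<Rightarrow> 'b::countable"
  assumes "\<And>i. (\<lambda>x. f x i) \<in> M \<rightarrow>\<^sub>M count_space UNIV"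
  shows "f \<in> M \<rightarrow>\<^sub>M count_space UNIV"
proof (subst measurable_count_space_eq2_countable, safe)
  fix g
  have "f -` {g} \<inter> space M = {x \<in> space M. \<forall>i. f x i = g i}"
    by (auto simp: fun_eq_iff)
  also have "\<dots> \<in> sets M"
    using assms by measurable
  finally show "f -` {g} \<inter> space M \<in> sets M" .
qed (use assms in auto)

lemma measurable_hist:
  fixes \<pi> :: "('k::finite, 'x, 'r, 's) protocol"
  assumes "valid_protocol \<pi>" and r: "r \<in> space (PiM UNIV (priv_coins \<pi>))"
  shows "(\<lambda>s. hist \<pi> x r s t) \<in> pub_coins \<pi> \<rightarrow>\<^sub>M count_space UNIV"
proof (induction t)
  case (Suc t)
  have hj: "(\<lambda>s. hist \<pi> x r s t j) \<in> pub_coins \<pi> \<rightarrow>\<^sub>M count_space UNIV" for j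
    by (rule measurable_compose[OF Suc]) simp
  have rj: "r j \<in> space (priv_coins \<pi> j)" for j
    using r by (auto simp: space_PiM)
  have view: "(\<lambda>s. (x j, r j, s, hist \<pi> x r s t j)) \<in> pub_coins \<pi> \<rightarrow>\<^sub>M view_space \<pi> j" for j
    unfolding view_space_def using hj[of j] rj[of j] by measurable
  have send: "send \<pi> j (Suc t) \<in> view_space \<pi> j \<rightarrow>\<^sub>M count_space UNIV" for j
    using assms(1) unfolding valid_protocol_def by simp
  have sj: "(\<lambda>s. send \<pi> j (Suc t) (x j, r j, s, hist \<pi> x r s t j)) \<in> pub_coins \<pi> \<rightarrow>\<^sub>M count_space UNIV" for j
    by (rule measurable_compose[OF view send])
  have "(\<lambda>s. hist \<pi> x r s (Suc t) i j) \<in> pub_coins \<pi> \<rightarrow>\<^sub>M count_space UNIV" for i j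
  proof -
    have "(\<lambda>s. hist \<pi> x r s t i j) \<in> pub_coins \<pi> \<rightarrow>\<^sub>M count_space UNIV"
      by (rule measurable_compose[OF hj[of i], where g = "\<lambda>h. h j"]) simp
    moreover have "(\<lambda>s. send \<pi> j (Suc t) (x j, r j, s, hist \<pi> x r s t j) i) \<in> pub_coins \<pi> \<rightarrow>\<^sub>M count_space UNIV"
      by (rule measurable_compose[OF sj[of j], where g = "\<lambda>m. m i"]) simp
    ultimately have "(\<lambda>s. (hist \<pi> x r s t i j, send \<pi> j (Suc t) (x j, r j, s, hist \<pi> x r s t j) i))
        \<in> pub_coins \<pi> \<rightarrow>\<^sub>M count_space UNIV \<Otimes>\<^sub>M count_space UNIV"
      by (rule measurable_Pair)
    \<comment> \<open>The product of these countable discrete spaces is discrete, so any function of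
      the pair is measurable.\<close>
    also have "count_space UNIV \<Otimes>\<^sub>M count_space UNIV = (count_space UNIV :: (msg list \<times> msg option) measure)"
      by (subst pair_measure_countable) auto
    finally have "(\<lambda>s. (\<lambda>(h, m). if i = j then [] else h @ [the m])
        (hist \<pi> x r s t i j, send \<pi> j (Suc t) (x j, r j, s, hist \<pi> x r s t j) i))
        \<in> pub_coins \<pi> \<rightarrow>\<^sub>M count_space UNIV"
      by (rule measurable_compose) simp
    then show ?thesis by (simp only: hist.simps prod.case)
  qed
  then show ?case
    by (intro measurable_fun_count_space)
qed simp

section \<open>Mutual information as an average over the coins\<close>

text \<open>Reweighting the product of the two marginals by the likelihood ratio restores the joint
  law. With the coins frozen, this identifies the density behind mutual information.\<close>

lemma bayes_sum:
  fixes p :: "'w::finite pmf"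
  shows "(\<Sum>w\<in>UNIV. pmf p w * (\<Sum>v\<in>UNIV. pmf p v *
      ((\<Sum>u\<in>UNIV. if X u = X w \<and> y u = y v then pmf p u else 0) / cell_prob p y v / cell_prob p X w
         * a (X w) (y v))))
    = (\<Sum>u\<in>UNIV. pmf p u * a (X u) (y u))" (is "?L = _")
proof -
  let ?t = "\<lambda>u v w. (if X w = X u then pmf p w else 0) * (if y v = y u then pmf p v else 0) *
      (pmf p u * a (X u) (y u) / (cell_prob p y u * cell_prob p X u))"
  have "pmf p w * (pmf p v * ((if X u = X w \<and> y u = y v then pmf p u else 0) / cell_prob p y v / cell_prob p X w
         * a (X w) (y v))) = ?t u v w" for u v w
  proof (cases "X u = X w \<and> y u = y v")
    case True
    then have "cell_prob p y u = cell_prob p y v" "cell_prob p X u = cell_prob p X w"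
      by (auto intro: cell_prob_cong)
    then show ?thesis using True by simp
  qed auto
  then have "?L = (\<Sum>w\<in>UNIV. \<Sum>v\<in>UNIV. \<Sum>u\<in>UNIV. ?t u v w)"
    unfolding sum_distrib_left sum_distrib_right sum_divide_distrib by (simp only:)
  also have "\<dots> = (\<Sum>w\<in>UNIV. \<Sum>u\<in>UNIV. \<Sum>v\<in>UNIV. ?t u v w)"
    by (rule sum.cong[OF refl], rule sum.swap)
  also have "\<dots> = (\<Sum>u\<in>UNIV. \<Sum>w\<in>UNIV. \<Sum>v\<in>UNIV. ?t u v w)"
    by (rule sum.swap)
  also have "\<dots> = (\<Sum>u\<in>UNIV. cell_prob p X u * cell_prob p y u *
      (pmf p u * a (X u) (y u) / (cell_prob p y u * cell_prob p X u)))"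
  proof -
    have "cell_prob p X u * cell_prob p y u * c = (\<Sum>w\<in>UNIV. \<Sum>v\<in>UNIV.
        (if X w = X u then pmf p w else 0) * (if y v = y u then pmf p v else 0) * c)" for u c
      unfolding cell_prob_def sum_distrib_right[symmetric] sum_distrib_left[symmetric] ..
    then show ?thesis by (simp only:)
  qed
  also have "\<dots> = (\<Sum>u\<in>UNIV. pmf p u * a (X u) (y u))"
  proof (rule sum.cong)
    fix u
    show "cell_prob p X u * cell_prob p y u *
      (pmf p u * a (X u) (y u) / (cell_prob p y u * cell_prob p X u)) = pmf p u * a (X u) (y u)"
    proof (cases "pmf p u = 0")
      case False
      then have "0 < pmf p u" by (simp add: pmf_nonneg order.not_eq_order_implies_strict)
      then have "0 < cell_prob p X u" "0 < cell_prob p y u"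
        by (auto intro: less_le_trans[OF _ pmf_le_cell_prob])
      then show ?thesis by simp
    qed simp
  qed simp
  finally show ?thesis .
qed

lemma sum_log_cell_prob:
  "(\<Sum>w\<in>UNIV. pmf p w * log 2 (cell_prob p (\<lambda>u. (X u, y u)) w / cell_prob p y w / cell_prob p X w))
    = ent p X + ent p y - ent p (\<lambda>w. (X w, y w))"
proof -
  have "pmf p w * log 2 (cell_prob p (\<lambda>u. (X u, y u)) w / cell_prob p y w / cell_prob p X w)
      = pmf p w * log 2 (cell_prob p (\<lambda>u. (X u, y u)) w) - pmf p w * log 2 (cell_prob p y w)
        - pmf p w * log 2 (cell_prob p X w)" for w
  proof (cases "pmf p w = 0")
    case False
    then have "0 < pmf p w" by (simp add: pmf_nonneg order.not_eq_order_implies_strict)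
    then have "0 < cell_prob p X w" "0 < cell_prob p y w" "0 < cell_prob p (\<lambda>u. (X u, y u)) w"
      by (auto intro: less_le_trans[OF _ pmf_le_cell_prob])
    then show ?thesis by (simp add: log_divide_pos log_mult_pos right_diff_distrib distrib_left)
  qed simp
  then show ?thesis
    by (simp add: ent_def sum_subtractf)
qed

text \<open>\<open>'w\<close> is finite, so only finitely many partitions occur as the coins vary,
  and a function of the partition takes finitely many values.\<close>

lemma integrable_partition_function:
  fixes F :: "'w::finite \<Rightarrow> 'r \<Rightarrow> 'd" and G :: "('w \<times> 'w) set \<Rightarrow> real"
  assumes "finite_measure N"
    and F: "\<And>u v. {\<rho> \<in> space N. F u \<rho> = F v \<rho>} \<in> sets N"
  shows "integrable N (\<lambda>\<rho>. G {(u, v). F u \<rho> = F v \<rho>})"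
proof -
  interpret finite_measure N by fact
  have "(\<lambda>\<rho>. {(u, v). F u \<rho> = F v \<rho>}) \<in> N \<rightarrow>\<^sub>M count_space UNIV"
  proof (subst measurable_count_space_eq2_countable, safe)
    fix K :: "('w \<times> 'w) set"
    have [measurable]: "Measurable.pred N (\<lambda>\<rho>. F u \<rho> = F v \<rho>)" for u v
      using F by (simp add: pred_def)
    have "(\<lambda>\<rho>. {(u, v). F u \<rho> = F v \<rho>}) -` {K} \<inter> space N =
        {\<rho> \<in> space N. \<forall>u v. (u, v) \<in> K \<longleftrightarrow> F u \<rho> = F v \<rho>}"
      by auto
    also have "\<dots> \<in> sets N" by measurable
    finally show "(\<lambda>\<rho>. {(u, v). F u \<rho> = F v \<rho>}) -` {K} \<inter> space N \<in> sets N" .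
  qed (auto intro: countable_finite)
  then have "(\<lambda>\<rho>. G {(u, v). F u \<rho> = F v \<rho>}) \<in> borel_measurable N"
    by (rule measurable_compose) simp
  moreover have "AE \<rho> in N. norm (G {(u, v). F u \<rho> = F v \<rho>}) \<le> Max (range (\<lambda>K. norm (G K)))"
    by (intro AE_I2 Max_ge) auto
  ultimately show ?thesis by (rule integrable_const_bound[rotated])
qed

lemma integrable_ent:
  fixes F :: "'w::finite \<Rightarrow> 'r \<Rightarrow> 'd"
  assumes "finite_measure N"
    and F: "\<And>u v. {\<rho> \<in> space N. F u \<rho> = F v \<rho>} \<in> sets N"
  shows "integrable N (\<lambda>\<rho>. ent p (\<lambda>w. F w \<rho>))"
  using integrable_partition_function[OF assms, where
      G = "\<lambda>K. - (\<Sum>w\<in>UNIV. pmf p w * log 2 (\<Sum>u\<in>UNIV. if (u, w) \<in> K then pmf p u else 0))"]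
  by (simp add: ent_def cell_prob_def)

lemma nn_integral_pmf_pair:
  fixes p :: "'w::finite pmf"
  assumes "sigma_finite_measure N" "g \<in> borel_measurable (measure_pmf p \<Otimes>\<^sub>M N)"
  shows "(\<integral>\<^sup>+\<omega>. g \<omega> \<partial>(measure_pmf p \<Otimes>\<^sub>M N)) = (\<Sum>w\<in>UNIV. ennreal (pmf p w) * (\<integral>\<^sup>+\<rho>. g (w, \<rho>) \<partial>N))"
proof -
  interpret sigma_finite_measure N by fact
  show ?thesis
    using assms(2)
    by (simp add: nn_integral_fst[symmetric] nn_integral_measure_pmf nn_integral_count_space_finite)
qed

lemma nn_integral_pmf_sum:
  fixes p :: "'w::finite pmf"
  assumes "\<And>w. g w \<in> borel_measurable N" and "\<And>w \<rho>. 0 \<le> g w \<rho>"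
  shows "(\<integral>\<^sup>+\<rho>. ennreal (\<Sum>w\<in>UNIV. pmf p w * g w \<rho>) \<partial>N) = (\<Sum>w\<in>UNIV. ennreal (pmf p w) * (\<integral>\<^sup>+\<rho>. ennreal (g w \<rho>) \<partial>N))"
  using assms by (simp add: sum_ennreal[symmetric] ennreal_mult nn_integral_sum nn_integral_cmult)

text \<open>\<open>q x y\<close> is the posterior probability of \<open>x\<close> given the
  observation \<open>y\<close>; \<open>qY\<close> says that knowing the coins as well would not
  change it. The joint law then has density \<open>q x y / P(X = x)\<close> with respect to the
  product of the marginals, and the KL divergence is the mean of its log.\<close>

lemma mutual_information_pmf_pair:
  fixes p :: "'w::finite pmf" and X :: "'w \<Rightarrow> 'x::finite" and q :: "'x \<Rightarrow> 't \<Rightarrow> real"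
  assumes N: "prob_space N"
    and Y: "Y \<in> measure_pmf p \<Otimes>\<^sub>M N \<rightarrow>\<^sub>M T"
    and q: "\<And>x. q x \<in> borel_measurable T" "\<And>x y. 0 \<le> q x y"
    and qY: "\<And>x w \<rho>. \<rho> \<in> space N \<Longrightarrow> q x (Y (w, \<rho>)) =
      (\<Sum>u\<in>UNIV. if X u = x \<and> Y (u, \<rho>) = Y (w, \<rho>) then pmf p u else 0) / cell_prob p (\<lambda>u. Y (u, \<rho>)) w"
    and eq: "\<And>u v. {\<rho> \<in> space N. Y (u, \<rho>) = Y (v, \<rho>)} \<in> sets N"
  shows "prob_space.mutual_information (measure_pmf p \<Otimes>\<^sub>M N) 2 (count_space UNIV) T (\<lambda>\<omega>. X (fst \<omega>)) Y
    = (\<integral>\<rho>. ent p X + ent p (\<lambda>w. Y (w, \<rho>)) - ent p (\<lambda>w. (X w, Y (w, \<rho>))) \<partial>N)"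
proof -
  let ?\<Omega> = "measure_pmf p \<Otimes>\<^sub>M N"
  let ?X = "\<lambda>\<omega> :: 'w \<times> _. X (fst \<omega>)"
  interpret N: prob_space N by fact
  interpret pmf: prob_space "measure_pmf p" by (rule prob_space_measure_pmf)
  interpret pair_prob_space "measure_pmf p" N ..
  note [measurable] = Y q
  have X [measurable]: "?X \<in> ?\<Omega> \<rightarrow>\<^sub>M count_space UNIV"
    by (rule measurable_compose[OF measurable_fst]) simp
  interpret DX: prob_space "distr ?\<Omega> (count_space UNIV) ?X"
    by (rule P.prob_space_distr) measurable
  interpret DY: prob_space "distr ?\<Omega> T Y"
    by (rule P.prob_space_distr) measurable
  interpret D: pair_prob_space "distr ?\<Omega> (count_space UNIV) ?X" "distr ?\<Omega> T Y" ..
  let ?M = "distr ?\<Omega> (count_space UNIV) ?X \<Otimes>\<^sub>M distr ?\<Omega> T Y"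
  define PX where "PX x = (\<Sum>u\<in>UNIV. if X u = x then pmf p u else 0)" for x
  have PX: "PX (X w) = cell_prob p X w" for w
    by (simp add: PX_def cell_prob_def)
  have PX0: "0 \<le> PX x" for x unfolding PX_def by (intro sum_nonneg) auto
  define f where "f = (\<lambda>(x, y). q x y / PX x)"
  have f0: "0 \<le> f z" for z using q(2) PX0 by (auto simp: f_def split: prod.split)
  have f [measurable]: "f \<in> borel_measurable (count_space UNIV \<Otimes>\<^sub>M T)"
    by (rule measurable_pair_measure_countable1) (auto simp: f_def)
  have setsM: "sets ?M = sets (count_space UNIV \<Otimes>\<^sub>M T)"
    by (rule sets_pair_measure_cong) simp_all
  have fM: "f \<in> borel_measurable ?M"
    using f by (simp only: measurable_cong_sets[OF setsM refl])
  have fMe: "(\<lambda>z. ennreal (f z)) \<in> borel_measurable ?M"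
    unfolding measurable_cong_sets[OF setsM refl] by measurable
  have density: "distr ?\<Omega> (count_space UNIV \<Otimes>\<^sub>M T) (\<lambda>\<omega>. (?X \<omega>, Y \<omega>)) = density ?M f"
  proof (rule measure_eqI)
    show "sets (distr ?\<Omega> (count_space UNIV \<Otimes>\<^sub>M T) (\<lambda>\<omega>. (?X \<omega>, Y \<omega>))) = sets (density ?M f)"
      by (simp only: sets_distr sets_density setsM)
    fix A assume "A \<in> sets (distr ?\<Omega> (count_space UNIV \<Otimes>\<^sub>M T) (\<lambda>\<omega>. (?X \<omega>, Y \<omega>)))"
    then have A [measurable]: "A \<in> sets (count_space UNIV \<Otimes>\<^sub>M T)" by simp
    have Yw [measurable]: "(\<lambda>\<rho>. Y (w, \<rho>)) \<in> N \<rightarrow>\<^sub>M T" for w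
      by measurable
    let ?a = "\<lambda>x y. indicator A (x, y) :: real"
    have "emeasure (density ?M f) A = (\<integral>\<^sup>+z. ennreal (f z) * indicator A z \<partial>?M)"
      by (rule emeasure_density[OF fMe]) (simp only: setsM A)
    also have "\<dots> = (\<integral>\<^sup>+x. (\<integral>\<^sup>+y. ennreal (f (x, y)) * indicator A (x, y) \<partial>distr ?\<Omega> T Y)
        \<partial>distr ?\<Omega> (count_space UNIV) ?X)"
    proof (rule DY.nn_integral_fst[symmetric])
      show "(\<lambda>z. ennreal (f z) * indicator A z) \<in> borel_measurable ?M"
        unfolding measurable_cong_sets[OF setsM refl] by measurable
    qed
    also have "\<dots> = (\<Sum>w\<in>UNIV. ennreal (pmf p w) *
        (\<integral>\<^sup>+y. ennreal (f (X w, y)) * indicator A (X w, y) \<partial>distr ?\<Omega> T Y))"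
      by (subst nn_integral_distr)
        (auto simp: nn_integral_pmf_pair N.sigma_finite_measure_axioms N.emeasure_space_1)
    also have "\<dots> = (\<Sum>w\<in>UNIV. ennreal (pmf p w) * (\<Sum>v\<in>UNIV. ennreal (pmf p v) *
        (\<integral>\<^sup>+\<rho>. ennreal (f (X w, Y (v, \<rho>)) * ?a (X w) (Y (v, \<rho>))) \<partial>N)))"
    proof (rule sum.cong[OF refl])
      fix w
      have "(\<integral>\<^sup>+y. ennreal (f (X w, y)) * indicator A (X w, y) \<partial>distr ?\<Omega> T Y)
        = (\<integral>\<^sup>+y. ennreal (f (X w, y) * ?a (X w) y) \<partial>distr ?\<Omega> T Y)"
        by (intro nn_integral_cong) (simp split: split_indicator)
      also have "\<dots> = (\<integral>\<^sup>+\<omega>. ennreal (f (X w, Y \<omega>) * ?a (X w) (Y \<omega>)) \<partial>?\<Omega>)"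
        by (rule nn_integral_distr) measurable
      also have "\<dots> = (\<Sum>v\<in>UNIV. ennreal (pmf p v) *
        (\<integral>\<^sup>+\<rho>. ennreal (f (X w, Y (v, \<rho>)) * ?a (X w) (Y (v, \<rho>))) \<partial>N))"
        by (rule nn_integral_pmf_pair[OF N.sigma_finite_measure_axioms]) measurable
      finally show "ennreal (pmf p w) * (\<integral>\<^sup>+y. ennreal (f (X w, y)) * indicator A (X w, y) \<partial>distr ?\<Omega> T Y)
        = ennreal (pmf p w) * (\<Sum>v\<in>UNIV. ennreal (pmf p v) *
        (\<integral>\<^sup>+\<rho>. ennreal (f (X w, Y (v, \<rho>)) * ?a (X w) (Y (v, \<rho>))) \<partial>N))"
        by simp
    qed
    also have "\<dots> = (\<integral>\<^sup>+\<rho>. ennreal (\<Sum>w\<in>UNIV. pmf p w * (\<Sum>v\<in>UNIV. pmf p v *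
        (f (X w, Y (v, \<rho>)) * ?a (X w) (Y (v, \<rho>))))) \<partial>N)"
      using f0 by (simp add: sum_ennreal[symmetric] ennreal_mult sum_nonneg nn_integral_sum nn_integral_cmult)
    also have "\<dots> = (\<integral>\<^sup>+\<rho>. ennreal (\<Sum>v\<in>UNIV. pmf p v * ?a (X v) (Y (v, \<rho>))) \<partial>N)"
    proof (rule nn_integral_cong)
      fix \<rho> assume "\<rho> \<in> space N"
      then show "ennreal (\<Sum>w\<in>UNIV. pmf p w * (\<Sum>v\<in>UNIV. pmf p v *
          (f (X w, Y (v, \<rho>)) * ?a (X w) (Y (v, \<rho>))))) = ennreal (\<Sum>v\<in>UNIV. pmf p v * ?a (X v) (Y (v, \<rho>)))"
        using bayes_sum[of p X "\<lambda>w. Y (w, \<rho>)" ?a] by (simp add: f_def qY PX)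
    qed
    also have "\<dots> = (\<Sum>v\<in>UNIV. ennreal (pmf p v) * (\<integral>\<^sup>+\<rho>. indicator A (X v, Y (v, \<rho>)) \<partial>N))"
      by (subst nn_integral_pmf_sum) (measurable, simp_all only: indicator_pos_le ennreal_indicator)
    also have "\<dots> = (\<integral>\<^sup>+\<omega>. indicator A (?X \<omega>, Y \<omega>) \<partial>?\<Omega>)"
      by (subst nn_integral_pmf_pair) (auto simp: N.sigma_finite_measure_axioms)
    also have "\<dots> = (\<integral>\<^sup>+z. indicator A z \<partial>distr ?\<Omega> (count_space UNIV \<Otimes>\<^sub>M T) (\<lambda>\<omega>. (?X \<omega>, Y \<omega>)))"
      by (rule nn_integral_distr[symmetric]) measurable
    also have "\<dots> = emeasure (distr ?\<Omega> (count_space UNIV \<Otimes>\<^sub>M T) (\<lambda>\<omega>. (?X \<omega>, Y \<omega>))) A"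
      by (rule nn_integral_indicator) simp
    finally show "emeasure (distr ?\<Omega> (count_space UNIV \<Otimes>\<^sub>M T) (\<lambda>\<omega>. (?X \<omega>, Y \<omega>))) A
      = emeasure (density ?M f) A" ..
  qed
  \<comment> \<open>The log density depends on the coins only through the partition
    \<open>K\<close>, hence is bounded. This gives the integrability that the exchange of integrals
    needs.\<close>
  define g where "g w K = log 2 ((\<Sum>u\<in>UNIV. if X u = X w \<and> (u, w) \<in> K then pmf p u else 0) /
      (\<Sum>u\<in>UNIV. if (u, w) \<in> K then pmf p u else 0) / PX (X w))" for w K
  have fg: "log 2 (f (X w, Y (w, \<rho>))) = g w {(u, v). Y (u, \<rho>) = Y (v, \<rho>)}" if "\<rho> \<in> space N" for w \<rho>
    using that by (simp add: f_def g_def qY cell_prob_def)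
  have "integrable ?\<Omega> (\<lambda>\<omega>. log 2 (f (?X \<omega>, Y \<omega>)))"
  proof (rule P.integrable_const_bound)
    have "norm (log 2 (f (X w, Y (w, \<rho>)))) \<le> Max (range (\<lambda>(w, K). norm (g w K)))" if "\<rho> \<in> space N" for w \<rho>
      unfolding fg[OF that] by (rule Max_ge) (auto intro: range_eqI[where x = "(_, _)"])
    then show "AE \<omega> in ?\<Omega>. norm (log 2 (f (?X \<omega>, Y \<omega>))) \<le> Max (range (\<lambda>(w, K). norm (g w K)))"
      by (intro AE_I2) (auto simp: space_pair_measure)
  qed measurable
  then have int: "integrable ?\<Omega> (\<lambda>(w, \<rho>). log 2 (f (X w, Y (w, \<rho>))))"
    by (simp add: case_prod_beta')
  have "prob_space.mutual_information ?\<Omega> 2 (count_space UNIV) T ?X Y = KL_divergence 2 ?M (density ?M f)"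
    unfolding P.mutual_information_def density ..
  also have "\<dots> = (\<integral>z. f z * log 2 (f z) \<partial>?M)"
    by (rule D.P.KL_density) (auto simp: fM f0)
  also have "\<dots> = (\<integral>z. log 2 (f z) \<partial>density ?M f)"
    using fM f0 by (subst integral_density) auto
  also have "\<dots> = (\<integral>\<omega>. log 2 (f (?X \<omega>, Y \<omega>)) \<partial>?\<Omega>)"
    unfolding density[symmetric] by (subst integral_distr) auto
  also have "\<dots> = (\<integral>(w, \<rho>). log 2 (f (X w, Y (w, \<rho>))) \<partial>?\<Omega>)"
    by (simp add: case_prod_beta')
  also have "\<dots> = (\<integral>\<rho>. (\<integral>w. log 2 (f (X w, Y (w, \<rho>))) \<partial>measure_pmf p) \<partial>N)"
    by (rule integral_snd[OF int, symmetric])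
  also have "\<dots> = (\<integral>\<rho>. ent p X + ent p (\<lambda>w. Y (w, \<rho>)) - ent p (\<lambda>w. (X w, Y (w, \<rho>))) \<partial>N)"
  proof (rule Bochner_Integration.integral_cong)
    fix \<rho> assume "\<rho> \<in> space N"
    then have "f (X w, Y (w, \<rho>)) = cell_prob p (\<lambda>u. (X u, Y (u, \<rho>))) w / cell_prob p (\<lambda>u. Y (u, \<rho>)) w / cell_prob p X w" for w
      by (simp add: f_def qY PX cell_prob_def[of p "\<lambda>u. (X u, Y (u, \<rho>))"])
    then show "(\<integral>w. log 2 (f (X w, Y (w, \<rho>))) \<partial>measure_pmf p)
        = ent p X + ent p (\<lambda>w. Y (w, \<rho>)) - ent p (\<lambda>w. (X w, Y (w, \<rho>)))"
      using sum_log_cell_prob[of p X "\<lambda>w. Y (w, \<rho>)"]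
      by (simp add: integral_measure_pmf_real[where A = UNIV] mult.commute)
  qed simp
  finally show ?thesis .
qed

section \<open>Variables that reveal the relevant coins\<close>

lemma pred_eq_count_space:
  fixes f g :: "'a \<Rightarrow> 'b::countable"
  assumes [measurable]: "f \<in> M \<rightarrow>\<^sub>M count_space UNIV" "g \<in> M \<rightarrow>\<^sub>M count_space UNIV"
  shows "Measurable.pred M (\<lambda>x. f x = g x)"
proof -
  have "Measurable.pred M (\<lambda>x. \<exists>c. f x = c \<and> g x = c)"
    by measurable
  then show ?thesis by (rule measurable_cong[THEN iffD1, rotated]) auto
qed

lemma measurable_Pair_count_space:
  fixes f :: "'a \<Rightarrow> 'b::countable" and g :: "'a \<Rightarrow> 'c::countable"
  assumes "f \<in> M \<rightarrow>\<^sub>M count_space UNIV" "g \<in> M \<rightarrow>\<^sub>M count_space UNIV"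
  shows "(\<lambda>x. (f x, g x)) \<in> M \<rightarrow>\<^sub>M count_space UNIV"
proof -
  have "count_space UNIV \<Otimes>\<^sub>M count_space UNIV = (count_space UNIV :: ('b \<times> 'c) measure)"
    by (subst pair_measure_countable) auto
  then show ?thesis using measurable_Pair[OF assms] by simp
qed

text \<open>
  \<open>Y\<close> reveals a coin-dependent function \<open>F\<close> of the discrete part of the sample, the coins \<open>e \<rho>\<close> that
  \<open>F\<close> depends on, and possibly further coins; \<open>D\<close> and \<open>c\<close> read the first two off \<open>Y\<close>.
\<close>
lemma mutual_information_revealed:
  fixes p :: "'w::finite pmf" and X :: "'w \<Rightarrow> 'x::finite" and F :: "'w \<Rightarrow> 's \<Rightarrow> 'd::countable"
  assumes N: "prob_space N"
    and Y: "Y \<in> measure_pmf p \<Otimes>\<^sub>M N \<rightarrow>\<^sub>M T"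
    and e: "e \<in> N \<rightarrow>\<^sub>M S" and F: "\<And>w. F w \<in> S \<rightarrow>\<^sub>M count_space UNIV"
    and D: "D \<in> T \<rightarrow>\<^sub>M count_space UNIV" and c: "c \<in> T \<rightarrow>\<^sub>M S"
    and DY: "\<And>w \<rho>. \<rho> \<in> space N \<Longrightarrow> D (Y (w, \<rho>)) = F w (e \<rho>)"
    and cY: "\<And>w \<rho>. \<rho> \<in> space N \<Longrightarrow> c (Y (w, \<rho>)) = e \<rho>"
    and FY: "\<And>u v \<rho>. \<rho> \<in> space N \<Longrightarrow> F u (e \<rho>) = F v (e \<rho>) \<Longrightarrow> Y (u, \<rho>) = Y (v, \<rho>)"
  shows "prob_space.mutual_information (measure_pmf p \<Otimes>\<^sub>M N) 2 (count_space UNIV) T (\<lambda>\<omega>. X (fst \<omega>)) Y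
    = (\<integral>\<rho>. ent p X + ent p (\<lambda>w. F w (e \<rho>)) - ent p (\<lambda>w. (X w, F w (e \<rho>))) \<partial>N)"
    and "integrable N (\<lambda>\<rho>. ent p X + ent p (\<lambda>w. F w (e \<rho>)) - ent p (\<lambda>w. (X w, F w (e \<rho>))))"
proof -
  interpret N: prob_space N by fact
  have YF: "Y (u, \<rho>) = Y (v, \<rho>) \<longleftrightarrow> F u (e \<rho>) = F v (e \<rho>)" if "\<rho> \<in> space N" for u v \<rho>
    using FY[OF that] DY[OF that] by metis
  have [measurable]: "(\<lambda>\<rho>. F w (e \<rho>)) \<in> N \<rightarrow>\<^sub>M count_space UNIV" for w
    using e F by (rule measurable_compose)
  have [measurable]: "Measurable.pred N (\<lambda>\<rho>. F u (e \<rho>) = F v (e \<rho>))" for u v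
    by (rule pred_eq_count_space) measurable
  have Fc: "(\<lambda>y. F w (c y)) \<in> T \<rightarrow>\<^sub>M count_space UNIV" for w
    using c F by (rule measurable_compose)
  have [measurable]: "Measurable.pred T (\<lambda>y. F u (c y) = D y)" for u
    by (rule pred_eq_count_space[OF Fc D])
  \<comment> \<open>\<open>F u (c y) = D y\<close> says that \<open>u\<close> is compatible with the
    observation \<open>y\<close>, so the posterior is computed from \<open>y\<close> alone.\<close>
  define q where "q x y = (\<Sum>u\<in>UNIV. if X u = x \<and> F u (c y) = D y then pmf p u else 0) /
      (\<Sum>u\<in>UNIV. if F u (c y) = D y then pmf p u else 0)" for x y
  have "prob_space.mutual_information (measure_pmf p \<Otimes>\<^sub>M N) 2 (count_space UNIV) T (\<lambda>\<omega>. X (fst \<omega>)) Y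
    = (\<integral>\<rho>. ent p X + ent p (\<lambda>w. Y (w, \<rho>)) - ent p (\<lambda>w. (X w, Y (w, \<rho>))) \<partial>N)"
  proof (rule mutual_information_pmf_pair[OF N Y])
    show "q x \<in> borel_measurable T" for x
      unfolding q_def by measurable
    show "0 \<le> q x y" for x y
      unfolding q_def by (intro divide_nonneg_nonneg sum_nonneg) auto
    show "q x (Y (w, \<rho>)) = (\<Sum>u\<in>UNIV. if X u = x \<and> Y (u, \<rho>) = Y (w, \<rho>) then pmf p u else 0) /
        cell_prob p (\<lambda>u. Y (u, \<rho>)) w" if "\<rho> \<in> space N" for x w \<rho>
      using that by (simp add: q_def cell_prob_def YF DY cY)
    show "{\<rho> \<in> space N. Y (u, \<rho>) = Y (v, \<rho>)} \<in> sets N" for u v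
    proof -
      have "{\<rho> \<in> space N. Y (u, \<rho>) = Y (v, \<rho>)} = {\<rho> \<in> space N. F u (e \<rho>) = F v (e \<rho>)}"
        using YF by blast
      also have "\<dots> \<in> sets N" by measurable
      finally show ?thesis .
    qed
  qed
  also have "\<dots> = (\<integral>\<rho>. ent p X + ent p (\<lambda>w. F w (e \<rho>)) - ent p (\<lambda>w. (X w, F w (e \<rho>))) \<partial>N)"
  proof (rule Bochner_Integration.integral_cong)
    fix \<rho> assume \<rho>: "\<rho> \<in> space N"
    have "ent p (\<lambda>w. Y (w, \<rho>)) = ent p (\<lambda>w. F w (e \<rho>))"
      by (intro ent_cong determinesI) (simp_all only: YF[OF \<rho>])
    moreover have "ent p (\<lambda>w. (X w, Y (w, \<rho>))) = ent p (\<lambda>w. (X w, F w (e \<rho>)))"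
      by (intro ent_cong determinesI) (simp_all only: YF[OF \<rho>] prod.inject)
    ultimately show "ent p X + ent p (\<lambda>w. Y (w, \<rho>)) - ent p (\<lambda>w. (X w, Y (w, \<rho>)))
        = ent p X + ent p (\<lambda>w. F w (e \<rho>)) - ent p (\<lambda>w. (X w, F w (e \<rho>)))"
      by simp
  qed simp
  finally show "prob_space.mutual_information (measure_pmf p \<Otimes>\<^sub>M N) 2 (count_space UNIV) T (\<lambda>\<omega>. X (fst \<omega>)) Y
    = (\<integral>\<rho>. ent p X + ent p (\<lambda>w. F w (e \<rho>)) - ent p (\<lambda>w. (X w, F w (e \<rho>))) \<partial>N)" .
  show "integrable N (\<lambda>\<rho>. ent p X + ent p (\<lambda>w. F w (e \<rho>)) - ent p (\<lambda>w. (X w, F w (e \<rho>))))"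
    by (intro Bochner_Integration.integrable_add Bochner_Integration.integrable_diff integrable_ent
        N.integrable_const) (unfold_locales, simp_all)
qed

text \<open>The difference of two instances of the preceding lemma, with \<open>F\<close> equal to
  the pair of \<open>a\<close> and \<open>b\<close> and to \<open>b\<close>. The decoders
  \<open>DA\<close>, \<open>DZ\<close> and \<open>c\<close> express that the observations contain
  these values and the coins they depend on.\<close>

lemma conditional_mutual_information_revealed:
  fixes p :: "'w::finite pmf" and X :: "'w \<Rightarrow> 'x::finite"
    and a :: "'w \<Rightarrow> 's \<Rightarrow> 'c::countable" and b :: "'w \<Rightarrow> 'd::countable"
  assumes N: "prob_space N"
    and e: "e \<in> N \<rightarrow>\<^sub>M S" and a: "\<And>w. a w \<in> S \<rightarrow>\<^sub>M count_space UNIV"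
    and A: "A \<in> measure_pmf p \<Otimes>\<^sub>M N \<rightarrow>\<^sub>M MA" and Z: "Z \<in> measure_pmf p \<Otimes>\<^sub>M N \<rightarrow>\<^sub>M MZ"
    and DA: "DA \<in> MA \<rightarrow>\<^sub>M count_space UNIV" and DZ: "DZ \<in> MZ \<rightarrow>\<^sub>M count_space UNIV"
    and c: "c \<in> MZ \<rightarrow>\<^sub>M S"
    and DAA: "\<And>w \<rho>. \<rho> \<in> space N \<Longrightarrow> DA (A (w, \<rho>)) = a w (e \<rho>)"
    and DZZ: "\<And>w \<rho>. \<rho> \<in> space N \<Longrightarrow> DZ (Z (w, \<rho>)) = b w"
    and cZ: "\<And>w \<rho>. \<rho> \<in> space N \<Longrightarrow> c (Z (w, \<rho>)) = e \<rho>"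
    and aA: "\<And>u v \<rho>. \<rho> \<in> space N \<Longrightarrow> a u (e \<rho>) = a v (e \<rho>) \<Longrightarrow> A (u, \<rho>) = A (v, \<rho>)"
    and bZ: "\<And>u v \<rho>. \<rho> \<in> space N \<Longrightarrow> b u = b v \<Longrightarrow> Z (u, \<rho>) = Z (v, \<rho>)"
  shows "prob_space.conditional_mutual_information (measure_pmf p \<Otimes>\<^sub>M N) 2 (count_space UNIV) MA MZ
      (\<lambda>\<omega>. X (fst \<omega>)) A Z = (\<integral>\<rho>. ent_cmi p X (\<lambda>w. a w (e \<rho>)) b \<partial>N)" (is ?thesis1)
    and "integrable N (\<lambda>\<rho>. ent_cmi p X (\<lambda>w. a w (e \<rho>)) b)" (is ?thesis2)
proof -
  interpret N: prob_space N by fact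
  interpret pmf: prob_space "measure_pmf p" by (rule prob_space_measure_pmf)
  interpret pair_prob_space "measure_pmf p" N ..
  let ?F = "\<lambda>w s. (a w s, b w)"
  have F: "?F w \<in> S \<rightarrow>\<^sub>M count_space UNIV" for w
    by (rule measurable_Pair_count_space[OF a]) simp
  have D: "(\<lambda>y. (DA (fst y), DZ (snd y))) \<in> MA \<Otimes>\<^sub>M MZ \<rightarrow>\<^sub>M count_space UNIV"
    by (rule measurable_Pair_count_space[OF measurable_compose[OF measurable_fst DA]
          measurable_compose[OF measurable_snd DZ]])
  have AZ: "(\<lambda>\<omega>. (A \<omega>, Z \<omega>)) \<in> measure_pmf p \<Otimes>\<^sub>M N \<rightarrow>\<^sub>M MA \<Otimes>\<^sub>M MZ"
    by (rule measurable_Pair[OF A Z])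
  note 1 = mutual_information_revealed[where X = X and F = ?F, OF N AZ e F D measurable_compose[OF measurable_snd c]]
  note 2 = mutual_information_revealed[where X = X and F = "\<lambda>w s. b w", OF N Z e _ DZ c]
  have eq: "ent_cmi p X (\<lambda>w. a w (e \<rho>)) b =
      (ent p X + ent p (\<lambda>w. (a w (e \<rho>), b w)) - ent p (\<lambda>w. (X w, (a w (e \<rho>), b w))))
      - (ent p X + ent p b - ent p (\<lambda>w. (X w, b w)))" for \<rho>
    by (simp add: ent_cmi_def)
  have i1: "integrable N (\<lambda>\<rho>. ent p X + ent p (\<lambda>w. (a w (e \<rho>), b w)) - ent p (\<lambda>w. (X w, (a w (e \<rho>), b w))))"
    by (rule 1(2)) (auto simp: DAA DZZ cZ intro: aA bZ)
  have i2: "integrable N (\<lambda>\<rho>. ent p X + ent p b - ent p (\<lambda>w. (X w, b w)))"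
    by simp
  show ?thesis2
    unfolding eq by (rule Bochner_Integration.integrable_diff[OF i1 i2])
  have "P.mutual_information 2 (count_space UNIV) (MA \<Otimes>\<^sub>M MZ) (\<lambda>\<omega>. X (fst \<omega>)) (\<lambda>\<omega>. (A \<omega>, Z \<omega>))
    = (\<integral>\<rho>. ent p X + ent p (\<lambda>w. (a w (e \<rho>), b w)) - ent p (\<lambda>w. (X w, (a w (e \<rho>), b w))) \<partial>N)"
    by (rule 1(1)) (auto simp: DAA DZZ cZ intro: aA bZ)
  moreover have "P.mutual_information 2 (count_space UNIV) MZ (\<lambda>\<omega>. X (fst \<omega>)) Z
    = (\<integral>\<rho>. ent p X + ent p b - ent p (\<lambda>w. (X w, b w)) \<partial>N)"
    by (rule 2(1)) (auto simp: DZZ cZ intro: bZ)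
  ultimately show ?thesis1
    unfolding P.conditional_mutual_information_def eq
    by (simp only: Bochner_Integration.integral_diff[OF i1 i2])
qed

section \<open>The comparison of the costs\<close>

lemma measurable_pmf_pair:
  fixes p :: "'w::finite pmf"
  assumes "\<And>w. (\<lambda>\<rho>. f (w, \<rho>)) \<in> N \<rightarrow>\<^sub>M K"
  shows "f \<in> measure_pmf p \<Otimes>\<^sub>M N \<rightarrow>\<^sub>M K"
proof -
  have "sets (measure_pmf p \<Otimes>\<^sub>M N) = sets (count_space UNIV \<Otimes>\<^sub>M N)"
    by (rule sets_pair_measure_cong) simp_all
  then have "measure_pmf p \<Otimes>\<^sub>M N \<rightarrow>\<^sub>M K = count_space UNIV \<Otimes>\<^sub>M N \<rightarrow>\<^sub>M K"
    by (rule measurable_cong_sets) simp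
  moreover have "f \<in> count_space UNIV \<Otimes>\<^sub>M N \<rightarrow>\<^sub>M K"
    using assms by (intro measurable_pair_measure_countable1) (auto intro: countable_finite)
  ultimately show ?thesis by simp
qed

theorem theorem7p13:
  fixes \<pi> :: "('k::finite, 'n::finite \<Rightarrow> bool, 'r, 's) protocol"
  assumes "valid_protocol \<pi>"
    and "public_coins_protocol \<pi>"
    and "proper_synchronous \<pi>"
  shows "PIC \<pi> \<ge> 1/2 * SMIC \<pi>"
proof -
  define R where "R = PiM UNIV (priv_coins \<pi>)"
  define N where "N = R \<Otimes>\<^sub>M pub_coins \<pi>"
  let ?p = "mu_n :: ('n \<Rightarrow> ('k \<Rightarrow> bool) \<times> bool \<times> 'k) pmf"
  have priv: "\<And>i. prob_space (priv_coins \<pi> i)" and pub: "prob_space (pub_coins \<pi>)"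
    using assms(1) by (auto simp: valid_protocol_def)
  interpret R: prob_space R
    unfolding R_def by (intro prob_space_PiM priv)
  interpret pub: prob_space "pub_coins \<pi>" by fact
  interpret RP: pair_prob_space R "pub_coins \<pi>" ..
  have N: "prob_space N"
    unfolding N_def by (rule RP.prob_space_axioms)
  \<comment> \<open>An arbitrary choice of private strings, to be substituted for the actual
    ones.\<close>
  obtain r0 where r0: "r0 \<in> space (PiM UNIV (priv_coins \<pi>))"
    using R.not_empty unfolding R_def by blast
  obtain tf where tf: "tf \<ge> 1" and proper:
    "\<And>x r s c i. r \<in> space (PiM UNIV (priv_coins \<pi>)) \<Longrightarrow> s \<in> space (pub_coins \<pi>) \<Longrightarrow>
        reachable \<pi> x r s c \<and> phase (c i) = Ready \<longrightarrow>
        (let t = lround (c i); v = view_of x r s c i in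
          (t < tf \<longrightarrow> (\<forall>j. j \<noteq> i \<longrightarrow> send \<pi> i t v j \<noteq> None) \<and>
             decide \<pi> i t v = None \<and> await \<pi> i t v = - {i}) \<and>
          (t = tf \<longrightarrow> (\<forall>j. send \<pi> i t v j = None) \<and> decide \<pi> i t v \<noteq> None))"
    using assms(3) unfolding proper_synchronous_def by blast
  obtain t where t: "tf = Suc t"
    using tf by (cases tf) auto

  define X where "X w i j = fst (w j) i" for w :: "'n \<Rightarrow> ('k \<Rightarrow> bool) \<times> bool \<times> 'k" and i j
  define M where "M w j = fst (snd (w j))" for w :: "'n \<Rightarrow> ('k \<Rightarrow> bool) \<times> bool \<times> 'k" and j
  define Z where "Z w j = snd (snd (w j))" for w :: "'n \<Rightarrow> ('k \<Rightarrow> bool) \<times> bool \<times> 'k" and j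
  define h where "h s w = hist \<pi> (X w) r0 s t" for s w
  define T where "T i w s = (\<lambda>j. h s w j i, h s w i)" for i w s
  have rvX: "rv_X \<omega> = X (fst \<omega>)" and rvM: "rv_M \<omega> = M (fst \<omega>)" and rvZ: "rv_Z \<omega> = Z (fst \<omega>)"
    and rvR: "rv_R \<omega> = fst (snd \<omega>)" and rvRp: "rv_Rp \<omega> = snd (snd \<omega>)"
    for \<omega> :: "('k, 'n, 'r, 's) sample"
    by (simp_all add: rv_X_def rv_M_def rv_Z_def rv_R_def rv_Rp_def X_def M_def Z_def
        fun_eq_iff split: prod.split)
  have Pi: "rv_Pi \<pi> i (w, \<rho>) = T i w (snd \<rho>)" if "\<rho> \<in> space N" for i w \<rho>
  proof -
    obtain r s where \<rho>: "\<rho> = (r, s)" by force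
    have r: "r \<in> space (PiM UNIV (priv_coins \<pi>))" and s: "s \<in> space (pub_coins \<pi>)"
      using that by (simp_all add: \<rho> N_def R_def space_pair_measure)
    have "transcript \<pi> (X w) r s i = (\<lambda>j. hist \<pi> (X w) r s t j i, hist \<pi> (X w) r s t i)"
      by (rule transcript_eq_hist[OF assms(1) r s _ t]) (use proper[OF r s] in \<open>simp add: Let_def\<close>)
    also have "hist \<pi> (X w) r s t = h s w"
      unfolding h_def by (rule hist_public_coins[OF assms(2) r r0])
    finally show ?thesis
      by (simp add: rv_Pi_def rvX rvR rvRp \<rho> T_def)
  qed
  have T: "T i w \<in> pub_coins \<pi> \<rightarrow>\<^sub>M count_space UNIV" for i w
    unfolding T_def h_def by (rule measurable_compose[OF measurable_hist[OF assms(1) r0]]) simp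
  have snd: "snd \<in> N \<rightarrow>\<^sub>M pub_coins \<pi>"
    unfolding N_def by (rule measurable_snd)
  have [measurable]: "(\<lambda>\<rho>. rv_Pi \<pi> i (w, \<rho>)) \<in> N \<rightarrow>\<^sub>M count_space UNIV" for i w
    using measurable_compose[OF snd T] by (rule measurable_cong[THEN iffD2, rotated]) (rule Pi)
  have comp [measurable]: "(\<lambda>\<rho>. fst \<rho> i) \<in> N \<rightarrow>\<^sub>M priv_coins \<pi> i" for i
    unfolding N_def R_def by measurable
  have restr [measurable]: "(\<lambda>\<rho>. restrict (fst \<rho>) (- {i})) \<in> N \<rightarrow>\<^sub>M PiM (- {i}) (priv_coins \<pi>)" for i
    unfolding N_def R_def by (rule measurable_compose[OF measurable_fst measurable_restrict_subset]) simp
  note [measurable] = snd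

  let ?pic = "\<lambda>i s. ent_cmi ?p (\<lambda>w. restrict (X w) (- {i})) (\<lambda>w. T i w s) (\<lambda>w. X w i)"
  let ?smic1 = "\<lambda>i s. ent_cmi ?p (\<lambda>w. X w i) (\<lambda>w. T i w s) (\<lambda>w. (M w, Z w))"
  let ?smic2 = "\<lambda>i s. ent_cmi ?p M (\<lambda>w. T i w s) (\<lambda>w. (X w i, Z w))"
  \<comment> \<open>The private strings of the others are observed and the player's own are
    conditioned on. The messages depend only on the public string, so with \<open>e = snd\<close>
    the private strings leave the posterior unchanged and drop out.\<close>
  have pic: "cmi \<pi>
     (count_space UNIV)
     (count_space UNIV \<Otimes>\<^sub>M PiM (- {i}) (priv_coins \<pi>))
     (count_space UNIV \<Otimes>\<^sub>M priv_coins \<pi> i \<Otimes>\<^sub>M pub_coins \<pi>)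
     (\<lambda>\<omega>. restrict (rv_X \<omega>) (- {i}))
     (\<lambda>\<omega>. (rv_Pi \<pi> i \<omega>, restrict (rv_R \<omega>) (- {i})))
     (\<lambda>\<omega>. (rv_X \<omega> i, rv_R \<omega> i, rv_Rp \<omega>)) = (\<integral>\<rho>. ?pic i (snd \<rho>) \<partial>N)
     \<and> integrable N (\<lambda>\<rho>. ?pic i (snd \<rho>))" for i
    unfolding sample_space_def R_def[symmetric] N_def[symmetric] rvX
    by (rule conjI; rule conditional_mutual_information_revealed[where X = "\<lambda>w. restrict (X w) (- {i})"
          and a = "T i" and b = "\<lambda>w. X w i" and DA = fst and DZ = fst and c = "\<lambda>z. snd (snd z)"
          and A = "\<lambda>\<omega>. (rv_Pi \<pi> i \<omega>, restrict (rv_R \<omega>) (- {i}))"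
          and Z = "\<lambda>\<omega>. (X (fst \<omega>) i, rv_R \<omega> i, rv_Rp \<omega>)" and e = snd
          and MA = "count_space UNIV \<Otimes>\<^sub>M PiM (- {i}) (priv_coins \<pi>)"
          and MZ = "count_space UNIV \<Otimes>\<^sub>M priv_coins \<pi> i \<Otimes>\<^sub>M pub_coins \<pi>",
          OF N snd T measurable_pmf_pair measurable_pmf_pair])
      (simp_all add: rvR rvRp Pi)
  have smic1: "cmi \<pi> (count_space UNIV) (count_space UNIV)
       (count_space UNIV \<Otimes>\<^sub>M count_space UNIV \<Otimes>\<^sub>M pub_coins \<pi>)
       (\<lambda>\<omega>. rv_X \<omega> i) (rv_Pi \<pi> i) (\<lambda>\<omega>. (rv_M \<omega>, rv_Z \<omega>, rv_Rp \<omega>)) = (\<integral>\<rho>. ?smic1 i (snd \<rho>) \<partial>N)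
     \<and> integrable N (\<lambda>\<rho>. ?smic1 i (snd \<rho>))" for i
    unfolding sample_space_def R_def[symmetric] N_def[symmetric] rvX
    by (rule conjI; rule conditional_mutual_information_revealed[where X = "\<lambda>w. X w i"
          and a = "T i" and b = "\<lambda>w. (M w, Z w)" and DA = "\<lambda>y. y" and DZ = "\<lambda>z. (fst z, fst (snd z))"
          and c = "\<lambda>z. snd (snd z)"
          and A = "rv_Pi \<pi> i"
          and Z = "\<lambda>\<omega>. (rv_M \<omega>, rv_Z \<omega>, rv_Rp \<omega>)" and e = snd
          and MA = "count_space UNIV" and MZ = "count_space UNIV \<Otimes>\<^sub>M count_space UNIV \<Otimes>\<^sub>M pub_coins \<pi>",
          OF N snd T measurable_pmf_pair measurable_pmf_pair])
      (simp_all add: rvM rvZ rvRp Pi measurable_Pair_count_space)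
  have smic2: "cmi \<pi> (count_space UNIV) (count_space UNIV)
       (count_space UNIV \<Otimes>\<^sub>M count_space UNIV \<Otimes>\<^sub>M pub_coins \<pi>)
       rv_M (rv_Pi \<pi> i) (\<lambda>\<omega>. (rv_X \<omega> i, rv_Z \<omega>, rv_Rp \<omega>)) = (\<integral>\<rho>. ?smic2 i (snd \<rho>) \<partial>N)
     \<and> integrable N (\<lambda>\<rho>. ?smic2 i (snd \<rho>))" for i
    unfolding sample_space_def R_def[symmetric] N_def[symmetric] rvM[abs_def]
    by (rule conjI; rule conditional_mutual_information_revealed[where X = M
          and a = "T i" and b = "\<lambda>w. (X w i, Z w)" and DA = "\<lambda>y. y" and DZ = "\<lambda>z. (fst z, fst (snd z))"
          and c = "\<lambda>z. snd (snd z)"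
          and A = "rv_Pi \<pi> i"
          and Z = "\<lambda>\<omega>. (rv_X \<omega> i, rv_Z \<omega>, rv_Rp \<omega>)" and e = snd
          and MA = "count_space UNIV" and MZ = "count_space UNIV \<Otimes>\<^sub>M count_space UNIV \<Otimes>\<^sub>M pub_coins \<pi>",
          OF N snd T measurable_pmf_pair measurable_pmf_pair])
      (simp_all add: rvX rvZ rvRp Pi measurable_Pair_count_space)

  have "SMIC \<pi> = (\<integral>\<rho>. (\<Sum>i\<in>UNIV. ?smic1 i (snd \<rho>) + ?smic2 i (snd \<rho>)) \<partial>N)"
    unfolding SMIC_def using smic1 smic2 by simp
  then have "1/2 * SMIC \<pi> = (\<integral>\<rho>. 1/2 * (\<Sum>i\<in>UNIV. ?smic1 i (snd \<rho>) + ?smic2 i (snd \<rho>)) \<partial>N)"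
    by simp
  also have "\<dots> \<le> (\<integral>\<rho>. (\<Sum>i\<in>UNIV. ?pic i (snd \<rho>)) \<partial>N)"
  proof (rule integral_mono)
    fix \<rho> :: "('k \<Rightarrow> 'r) \<times> 's"
    have "(\<Sum>i\<in>UNIV. ent ?p (\<lambda>w. (X w i, M w, Z w)))
        \<le> ent ?p (\<lambda>w. (X w, M w, Z w)) + (real CARD('k) - 1) * ent ?p (\<lambda>w. (M w, Z w))"
      using ent_mu_n[where 'n = 'n and 'k = 'k] by (simp add: X_def[abs_def] M_def[abs_def] Z_def[abs_def])
    \<comment> \<open>The constant diagonal \<open>e\<close> is the empty list, because no player
      writes to itself.\<close>
    then show "1/2 * (\<Sum>i\<in>UNIV. ?smic1 i (snd \<rho>) + ?smic2 i (snd \<rho>)) \<le> (\<Sum>i\<in>UNIV. ?pic i (snd \<rho>))"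
      unfolding T_def
      by (intro switched_cost_le_private_cost[where h = "h (snd \<rho>)" and e = "[]"])
        (auto simp: h_def intro: determinesI)
  qed (use smic1 smic2 pic in simp_all)
  also have "\<dots> = PIC \<pi>"
    unfolding PIC_def using pic by simp
  finally show ?thesis .
qed

end
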